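(* Let $(\Omega_i,\mathcal A_i,\mu_i)$ be a measure space with finite measure, $i=1,2$, and let $\nabla_i$ be the complete Boolean algebra of classes of $\mu_i$-almost everywhere equal sets from $\mathcal A_i$, equipped with the strictly positive measure induced by $\mu_i$ (again denoted $\mu_i$). Then the $F$-spaces $L_{\log}(\Omega_1,\mathcal A_1,\mu_1)$ and $L_{\log}(\Omega_2,\mathcal A_2,\mu_2)$ are isometric if and only if there exists a measure-preserving Boolean isomorphism $\varphi:(\nabla_1,\mu_1)\to(\nabla_2,\mu_2)$, i.e. a Boolean isomorphism $\varphi$ of $\nabla_1$ onto $\nabla_2$ with $\mu_2(\varphi(e))=\mu_1(e)$ for all $e\in\nabla_1$.
   Context: Fix the scalar field to be $\mathbb R$ or $\mathbb C$ (the same for both spaces). For a finite measure space $(\Omega,\mathcal A,\mu)$, $L_0(\Omega,\mathcal A,\mu)$ is the algebra of $\mu$-a.e. equivalence classes of a.e. finite scalar-valued measurable functions, and $$L_{\log}(\Omega,\mathcal A,\mu)=\Big\{f\in L_0(\Omega,\mathcal A,\mu):\ \|f\|_{\log,\mu}=\int_\Omega\log(1+|f|)\,d\mu<\infty\Big\}.$$ This is a vector space, $\|\cdot\|_{\log,\mu}$ is an $F$-norm on it, and $\rho(f,g)=\|f-g\|_{\log,\mu}$ is a complete metric. Two such spaces are called isometric if there is a surjective linear map $U$ from one onto the other with $\|U(f)\|_{\log,\mu_2}=\|f\|_{\log,\mu_1}$ for all $f$. *)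

theory Defs
  imports "HOL-Analysis.Analysis"
begin

section \<open>The algebra of classes of measurable scalar functions\<close>

text \<open>The scalar type \<open>'k\<close> is meant to be instantiated by \<^typ>\<open>real\<close> or \<^typ>\<open>complex\<close>.
  A class of a.e. finite measurable functions always contains an everywhere finite
  representative, so \<open>L0\<close> is a quotient of the measurable functions with values in \<open>'k\<close>.
  Values outside \<open>space M\<close> are irrelevant to the relation below.\<close>

definition ae_eq :: "'a measure \<Rightarrow> (('a \<Rightarrow> 'k::real_normed_field) \<times> ('a \<Rightarrow> 'k)) set" where
  "ae_eq M = {(f, g). f \<in> borel_measurable M \<and> g \<in> borel_measurable M \<and> (AE x in M. f x = g x)}"

definition L0 :: "'a measure \<Rightarrow> ('a \<Rightarrow> 'k::real_normed_field) set set" where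
  "L0 M = borel_measurable M // ae_eq M"

definition L0_add :: "'a measure \<Rightarrow> ('a \<Rightarrow> 'k::real_normed_field) set \<Rightarrow> ('a \<Rightarrow> 'k) set \<Rightarrow> ('a \<Rightarrow> 'k) set" where
  "L0_add M F G = (\<Union>f\<in>F. \<Union>g\<in>G. ae_eq M `` {\<lambda>x. f x + g x})"

definition L0_scale :: "'a measure \<Rightarrow> 'k \<Rightarrow> ('a \<Rightarrow> 'k::real_normed_field) set \<Rightarrow> ('a \<Rightarrow> 'k) set" where
  "L0_scale M c F = (\<Union>f\<in>F. ae_eq M `` {\<lambda>x. c * f x})"

text \<open>The value does not depend on the chosen representative, see \<open>log_norm_class\<close>.\<close>

definition log_norm :: "'a measure \<Rightarrow> ('a \<Rightarrow> 'k::real_normed_field) set \<Rightarrow> ennreal" where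
  "log_norm M F = (\<integral>\<^sup>+x. ennreal (ln (1 + norm ((SOME f. f \<in> F) x))) \<partial>M)"

definition L_log :: "'a measure \<Rightarrow> ('a \<Rightarrow> 'k::real_normed_field) set set" where
  "L_log M = {F \<in> L0 M. log_norm M F < \<infinity>}"

text \<open>Surjective linear isometries; only the values of \<open>U\<close> on \<open>L_log M\<close> matter.\<close>

definition L_log_isometry ::
  "'a measure \<Rightarrow> 'b measure \<Rightarrow> (('a \<Rightarrow> 'k::real_normed_field) set \<Rightarrow> ('b \<Rightarrow> 'k) set) \<Rightarrow> bool" where
  "L_log_isometry M N U \<longleftrightarrow>
     U ` L_log M = L_log N \<and>
     (\<forall>F\<in>L_log M. \<forall>G\<in>L_log M. U (L0_add M F G) = L0_add N (U F) (U G)) \<and>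
     (\<forall>c. \<forall>F\<in>L_log M. U (L0_scale M c F) = L0_scale N c (U F)) \<and>
     (\<forall>F\<in>L_log M. log_norm N (U F) = log_norm M F)"


section \<open>The Boolean algebra of classes of measurable sets\<close>

definition set_eq :: "'a measure \<Rightarrow> ('a set \<times> 'a set) set" where
  "set_eq M = {(A, B). A \<in> sets M \<and> B \<in> sets M \<and> sym_diff A B \<in> null_sets M}"

definition nabla :: "'a measure \<Rightarrow> 'a set set set" where
  "nabla M = sets M // set_eq M"

definition nabla_sup :: "'a measure \<Rightarrow> 'a set set \<Rightarrow> 'a set set \<Rightarrow> 'a set set" where
  "nabla_sup M d e = (\<Union>A\<in>d. \<Union>B\<in>e. set_eq M `` {A \<union> B})"

definition nabla_inf :: "'a measure \<Rightarrow> 'a set set \<Rightarrow> 'a set set \<Rightarrow> 'a set set" where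
  "nabla_inf M d e = (\<Union>A\<in>d. \<Union>B\<in>e. set_eq M `` {A \<inter> B})"

definition nabla_compl :: "'a measure \<Rightarrow> 'a set set \<Rightarrow> 'a set set" where
  "nabla_compl M e = (\<Union>A\<in>e. set_eq M `` {space M - A})"

text \<open>Independent of the representative, see \<open>nabla_measure_class\<close>.\<close>

definition nabla_measure :: "'a measure \<Rightarrow> 'a set set \<Rightarrow> ennreal" where
  "nabla_measure M e = emeasure M (SOME A. A \<in> e)"

definition boolean_iso :: "'a measure \<Rightarrow> 'b measure \<Rightarrow> ('a set set \<Rightarrow> 'b set set) \<Rightarrow> bool" where
  "boolean_iso M N \<phi> \<longleftrightarrow>
     bij_betw \<phi> (nabla M) (nabla N) \<and>
     (\<forall>d\<in>nabla M. \<forall>e\<in>nabla M. \<phi> (nabla_sup M d e) = nabla_sup N (\<phi> d) (\<phi> e)) \<and>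
     (\<forall>d\<in>nabla M. \<forall>e\<in>nabla M. \<phi> (nabla_inf M d e) = nabla_inf N (\<phi> d) (\<phi> e)) \<and>
     (\<forall>e\<in>nabla M. \<phi> (nabla_compl M e) = nabla_compl N (\<phi> e))"

definition measure_preserving_boolean_iso ::
  "'a measure \<Rightarrow> 'b measure \<Rightarrow> ('a set set \<Rightarrow> 'b set set) \<Rightarrow> bool" where
  "measure_preserving_boolean_iso M N \<phi> \<longleftrightarrow>
     boolean_iso M N \<phi> \<and> (\<forall>e\<in>nabla M. nabla_measure N (\<phi> e) = nabla_measure M e)"


section \<open>Well-definedness\<close>

lemma equiv_ae_eq: "equiv (borel_measurable M) (ae_eq M)"
proof (rule equivI)
  show "trans (ae_eq M)"
    by (rule transI) (auto simp: ae_eq_def)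
qed (auto simp: ae_eq_def refl_on_def sym_def elim: AE_mp)

lemma in_class_iff:
  "f \<in> borel_measurable M \<Longrightarrow> g \<in> ae_eq M `` {f} \<longleftrightarrow> g \<in> borel_measurable M \<and> (AE x in M. f x = g x)"
  by (simp add: ae_eq_def)

lemma class_eqI:
  assumes "f \<in> borel_measurable M" "g \<in> borel_measurable M" "AE x in M. f x = g x"
  shows "ae_eq M `` {f} = ae_eq M `` {g}"
  using assms by (intro equiv_class_eq[OF equiv_ae_eq]) (simp add: ae_eq_def)

lemma L0_add_class:
  fixes f g :: "'a \<Rightarrow> 'k::{real_normed_field, second_countable_topology}"
  assumes [measurable]: "f \<in> borel_measurable M" "g \<in> borel_measurable M"
  shows "L0_add M (ae_eq M `` {f}) (ae_eq M `` {g}) = ae_eq M `` {\<lambda>x. f x + g x}"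
proof -
  have "ae_eq M `` {\<lambda>x. f' x + g' x} = ae_eq M `` {\<lambda>x. f x + g x}"
    if "f' \<in> ae_eq M `` {f}" "g' \<in> ae_eq M `` {g}" for f' g'
  proof -
    from that have [measurable]: "f' \<in> borel_measurable M" "g' \<in> borel_measurable M"
      and "AE x in M. f x = f' x" "AE x in M. g x = g' x"
      using assms by (auto simp: ae_eq_def)
    then have "AE x in M. f' x + g' x = f x + g x" by auto
    then show ?thesis by (intro class_eqI) auto
  qed
  moreover have "f \<in> ae_eq M `` {f}" "g \<in> ae_eq M `` {g}"
    using assms by (auto simp: ae_eq_def)
  ultimately show ?thesis
    unfolding L0_add_def by blast
qed

lemma L0_scale_class:
  fixes f :: "'a \<Rightarrow> 'k::{real_normed_field, second_countable_topology}"
  assumes [measurable]: "f \<in> borel_measurable M"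
  shows "L0_scale M c (ae_eq M `` {f}) = ae_eq M `` {\<lambda>x. c * f x}"
proof -
  have "ae_eq M `` {\<lambda>x. c * f' x} = ae_eq M `` {\<lambda>x. c * f x}"
    if "f' \<in> ae_eq M `` {f}" for f'
  proof -
    from that have [measurable]: "f' \<in> borel_measurable M" and ae: "AE x in M. f x = f' x"
      using assms by (auto simp: ae_eq_def)
    from ae have "AE x in M. c * f' x = c * f x" by eventually_elim simp
    then show ?thesis by (intro class_eqI) auto
  qed
  moreover have "f \<in> ae_eq M `` {f}"
    using assms by (auto simp: ae_eq_def)
  ultimately show ?thesis
    unfolding L0_scale_def by blast
qed

lemma log_norm_class:
  assumes "f \<in> borel_measurable M"
  shows "log_norm M (ae_eq M `` {f}) = (\<integral>\<^sup>+x. ennreal (ln (1 + norm (f x))) \<partial>M)"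
proof -
  have "f \<in> ae_eq M `` {f}" using assms by (auto simp: ae_eq_def)
  then have "(SOME g. g \<in> ae_eq M `` {f}) \<in> ae_eq M `` {f}" by (rule someI[where P="\<lambda>g. g \<in> ae_eq M `` {f}"])
  then have "AE x in M. f x = (SOME g. g \<in> ae_eq M `` {f}) x"
    using assms by (simp only: in_class_iff)
  then show ?thesis
    unfolding log_norm_def by (intro nn_integral_cong_AE) auto
qed

lemma L_log_iff:
  "F \<in> L_log M \<longleftrightarrow> (\<exists>f\<in>borel_measurable M. F = ae_eq M `` {f} \<and>
     (\<integral>\<^sup>+x. ennreal (ln (1 + norm (f x))) \<partial>M) < \<infinity>)"
  unfolding L_log_def L0_def by (auto simp: quotient_def log_norm_class)

lemma L0_add_in_L_log:
  fixes F G :: "('a \<Rightarrow> 'k::{real_normed_field, second_countable_topology}) set"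
  assumes "F \<in> L_log M" "G \<in> L_log M"
  shows "L0_add M F G \<in> L_log M"
proof -
  obtain f g where [measurable]: "f \<in> borel_measurable M" "g \<in> borel_measurable M"
    and eq: "F = ae_eq M `` {f}" "G = ae_eq M `` {g}"
    and fin: "(\<integral>\<^sup>+x. ennreal (ln (1 + norm (f x))) \<partial>M) < \<infinity>"
      "(\<integral>\<^sup>+x. ennreal (ln (1 + norm (g x))) \<partial>M) < \<infinity>"
    using assms unfolding L_log_iff by blast
  have "ln (1 + norm (f x + g x)) \<le> ln (1 + norm (f x)) + ln (1 + norm (g x))" for x
  proof -
    have "1 + norm (f x + g x) \<le> (1 + norm (f x)) * (1 + norm (g x))"
      using norm_triangle_ineq[of "f x" "g x"] mult_nonneg_nonneg[OF norm_ge_zero[of "f x"] norm_ge_zero[of "g x"]]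
      by (simp only: distrib_left distrib_right mult_1_left mult_1_right)
    then have "ln (1 + norm (f x + g x)) \<le> ln ((1 + norm (f x)) * (1 + norm (g x)))"
      by (intro ln_mono) (auto intro: add_pos_nonneg)
    then show ?thesis by (simp add: ln_mult add_pos_nonneg add_nonneg_eq_0_iff)
  qed
  then have "(\<integral>\<^sup>+x. ennreal (ln (1 + norm (f x + g x))) \<partial>M)
      \<le> (\<integral>\<^sup>+x. ennreal (ln (1 + norm (f x))) + ennreal (ln (1 + norm (g x))) \<partial>M)"
    by (intro nn_integral_mono) (simp flip: ennreal_plus)
  also have "\<dots> < \<infinity>"
    using fin by (subst nn_integral_add) auto
  finally show ?thesis
    unfolding L_log_iff eq by (subst L0_add_class) (auto intro!: bexI[of _ "\<lambda>x. f x + g x"])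
qed

lemma L0_scale_in_L_log:
  fixes F :: "('a \<Rightarrow> 'k::{real_normed_field, second_countable_topology}) set"
  assumes "finite_measure M" "F \<in> L_log M"
  shows "L0_scale M c F \<in> L_log M"
proof -
  interpret finite_measure M by fact
  obtain f where [measurable]: "f \<in> borel_measurable M"
    and eq: "F = ae_eq M `` {f}"
    and fin: "(\<integral>\<^sup>+x. ennreal (ln (1 + norm (f x))) \<partial>M) < \<infinity>"
    using assms unfolding L_log_iff by blast
  have "ln (1 + norm (c * f x)) \<le> ln (1 + norm c) + ln (1 + norm (f x))" for x
  proof -
    have "1 + norm (c * f x) \<le> (1 + norm c) * (1 + norm (f x))"
      by (simp add: algebra_simps norm_mult)
    then have "ln (1 + norm (c * f x)) \<le> ln ((1 + norm c) * (1 + norm (f x)))"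
      by (intro ln_mono) (auto intro: add_pos_nonneg)
    then show ?thesis by (simp add: ln_mult add_pos_nonneg add_nonneg_eq_0_iff)
  qed
  then have "(\<integral>\<^sup>+x. ennreal (ln (1 + norm (c * f x))) \<partial>M)
      \<le> (\<integral>\<^sup>+x. ennreal (ln (1 + norm c)) + ennreal (ln (1 + norm (f x))) \<partial>M)"
    by (intro nn_integral_mono) (simp flip: ennreal_plus)
  also have "\<dots> < \<infinity>"
    using fin by (subst nn_integral_add) (auto simp: ennreal_mult_eq_top_iff less_top[symmetric])
  finally show ?thesis
    unfolding L_log_iff eq by (subst L0_scale_class) (auto intro!: bexI[of _ "\<lambda>x. c * f x"])
qed

lemma set_eq_iff_AE:
  assumes "A \<in> sets M" "B \<in> sets M"
  shows "(A, B) \<in> set_eq M \<longleftrightarrow> (AE x in M. x \<in> A \<longleftrightarrow> x \<in> B)"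
proof -
  have "{x \<in> space M. \<not> (x \<in> A \<longleftrightarrow> x \<in> B)} = sym_diff A B"
    using assms[THEN sets.sets_into_space] by auto
  with assms show ?thesis
    by (subst AE_iff_null) (auto simp: set_eq_def)
qed

lemma equiv_set_eq: "equiv (sets M) (set_eq M)"
proof (rule equivI)
  show "trans (set_eq M)"
  proof (rule transI)
    fix A B C assume *: "(A, B) \<in> set_eq M" "(B, C) \<in> set_eq M"
    then have s: "A \<in> sets M" "B \<in> sets M" "C \<in> sets M" by (auto simp: set_eq_def)
    from * s have "AE x in M. x \<in> A \<longleftrightarrow> x \<in> B" "AE x in M. x \<in> B \<longleftrightarrow> x \<in> C"
      by (simp_all add: set_eq_iff_AE)
    then show "(A, C) \<in> set_eq M"
      using s by (subst set_eq_iff_AE) auto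
  qed
qed (auto simp: set_eq_def refl_on_def sym_def Un_commute)

lemma set_class_eqI:
  assumes "A \<in> sets M" "B \<in> sets M" "AE x in M. x \<in> A \<longleftrightarrow> x \<in> B"
  shows "set_eq M `` {A} = set_eq M `` {B}"
  using assms by (intro equiv_class_eq[OF equiv_set_eq]) (simp add: set_eq_iff_AE)

lemma in_set_class:
  assumes "A \<in> sets M" "B \<in> set_eq M `` {A}"
  shows "B \<in> sets M" "AE x in M. x \<in> A \<longleftrightarrow> x \<in> B"
proof -
  show "B \<in> sets M" using assms by (auto simp: set_eq_def)
  then show "AE x in M. x \<in> A \<longleftrightarrow> x \<in> B" using assms by (simp add: set_eq_iff_AE)
qed

lemma self_in_set_class: "A \<in> sets M \<Longrightarrow> A \<in> set_eq M `` {A}"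
  by (simp add: set_eq_def)

lemma nabla_sup_class:
  assumes "A \<in> sets M" "B \<in> sets M"
  shows "nabla_sup M (set_eq M `` {A}) (set_eq M `` {B}) = set_eq M `` {A \<union> B}"
proof -
  have "set_eq M `` {A' \<union> B'} = set_eq M `` {A \<union> B}"
    if "A' \<in> set_eq M `` {A}" "B' \<in> set_eq M `` {B}" for A' B'
  proof (rule set_class_eqI)
    show "AE x in M. x \<in> A' \<union> B' \<longleftrightarrow> x \<in> A \<union> B"
      using in_set_class(2)[OF assms(1) that(1)] in_set_class(2)[OF assms(2) that(2)] by auto
  qed (use in_set_class(1)[OF assms(1) that(1)] in_set_class(1)[OF assms(2) that(2)] assms in auto)
  with self_in_set_class[OF assms(1)] self_in_set_class[OF assms(2)] show ?thesis
    unfolding nabla_sup_def by blast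
qed

lemma nabla_inf_class:
  assumes "A \<in> sets M" "B \<in> sets M"
  shows "nabla_inf M (set_eq M `` {A}) (set_eq M `` {B}) = set_eq M `` {A \<inter> B}"
proof -
  have "set_eq M `` {A' \<inter> B'} = set_eq M `` {A \<inter> B}"
    if "A' \<in> set_eq M `` {A}" "B' \<in> set_eq M `` {B}" for A' B'
  proof (rule set_class_eqI)
    show "AE x in M. x \<in> A' \<inter> B' \<longleftrightarrow> x \<in> A \<inter> B"
      using in_set_class(2)[OF assms(1) that(1)] in_set_class(2)[OF assms(2) that(2)] by auto
  qed (use in_set_class(1)[OF assms(1) that(1)] in_set_class(1)[OF assms(2) that(2)] assms in auto)
  with self_in_set_class[OF assms(1)] self_in_set_class[OF assms(2)] show ?thesis
    unfolding nabla_inf_def by blast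
qed

lemma nabla_compl_class:
  assumes "A \<in> sets M"
  shows "nabla_compl M (set_eq M `` {A}) = set_eq M `` {space M - A}"
proof -
  have "set_eq M `` {space M - A'} = set_eq M `` {space M - A}"
    if "A' \<in> set_eq M `` {A}" for A'
  proof (rule set_class_eqI)
    show "AE x in M. x \<in> space M - A' \<longleftrightarrow> x \<in> space M - A"
      using in_set_class(2)[OF assms(1) that(1)] by auto
  qed (use in_set_class(1)[OF assms(1) that(1)] assms in auto)
  with self_in_set_class[OF assms(1)] show ?thesis
    unfolding nabla_compl_def by blast
qed

lemma nabla_measure_class:
  assumes "A \<in> sets M"
  shows "nabla_measure M (set_eq M `` {A}) = emeasure M A"
proof -
  have "(SOME B. B \<in> set_eq M `` {A}) \<in> set_eq M `` {A}"
    using self_in_set_class[OF assms] by (rule someI)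
  from in_set_class[OF assms this] show ?thesis
    unfolding nabla_measure_def using assms by (intro emeasure_eq_AE) auto
qed

end

theory Submission
  imports Defs "HOL-Real_Asymp.Real_Asymp"
begin

text \<open>A linear isometry \<open>U\<close> satisfies \<open>\<integral> ln (1 + t \<bar>U f\<bar>) = \<integral> ln (1 + t \<bar>f\<bar>)\<close> for every \<open>t > 0\<close>, because
  it commutes with scaling by \<open>t\<close>. This one-parameter family of integrals carries much
  information on the distribution of the modulus. For an indicator \<open>f\<close> of a set of measure \<open>m\<close> the
  value is \<open>m ln (1 + t)\<close>, and \<open>log_moments_of_indicator\<close> shows that only functions whose modulus is
  itself the indicator of a set of measure \<open>m\<close> have these values. Hence \<open>U\<close> preserves the functions
  that are unimodular on their support, together with the measure of the support.

  Applied to two such functions with disjoint supports and to their sum, this yields that the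
  images have additive measures of supports, hence disjoint supports as well
  (\<open>disjoint_transfer\<close>). Applied to the constant function 1 and to the preimage of 1, it yields that
  the total measures agree and that \<open>U 1\<close> is unimodular
  (\<open>indicator_space_full_support\<close>). The map sending \<open>A\<close> to the support of \<open>U 1\<^sub>A\<close> is then
  compatible with intersections and complements, preserves the measure, and is onto because the
  preimage of \<open>U 1\<close> times the indicator of \<open>B\<close> is again an indicator.

  Conversely, a measure preserving Boolean isomorphism is compatible with countable unions
  (\<open>UN_nat\<close>), by continuity of the measure. Two functions are called related if all
  their preimages of Borel sets correspond to each other. Each real function has a partner, rebuilt
  from the images of its sublevel sets at rational levels; Borel operations, and joint Borel
  operations on several functions, respect the relation. This gives partners for functions with
  values in a Euclidean space and shows that the correspondence is linear. Related functions have
  the same distribution, so the correspondence is isometric.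

  Both halves are symmetric in the two measure spaces. To use this, isometries and
  Boolean isomorphisms are treated as relations between functions and between sets, not as maps
  between classes: every lemma then also holds for the converse relation, inverse maps never
  have to be constructed, and representatives are handled by closure under almost everywhere
  equality.\<close>

section \<open>Log-integrable functions and supports\<close>

definition log_int :: "'a measure \<Rightarrow> ('a \<Rightarrow> 'k::real_normed_field) \<Rightarrow> ennreal" where
  "log_int M f = (\<integral>\<^sup>+x. ennreal (ln (1 + norm (f x))) \<partial>M)"

definition log_integrable :: "'a measure \<Rightarrow> ('a \<Rightarrow> 'k::real_normed_field) \<Rightarrow> bool" where
  "log_integrable M f \<longleftrightarrow> f \<in> borel_measurable M \<and> log_int M f < \<infinity>"

lemma log_integrable_iff_class:
  assumes "f \<in> borel_measurable M"
  shows "log_integrable M f \<longleftrightarrow> ae_eq M `` {f} \<in> L_log M"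
  using assms
  by (auto simp: log_integrable_def log_int_def L_log_def L0_def log_norm_class intro: quotientI)

lemma L_log_representative:
  assumes "F \<in> L_log M"
  obtains f where "log_integrable M f" "F = ae_eq M `` {f}"
  using assms unfolding L_log_iff log_integrable_def log_int_def by blast

lemma log_integrable_cong_AE:
  assumes "log_integrable M f" "f' \<in> borel_measurable M" "AE x in M. f x = f' x"
  shows "log_integrable M f'"
proof -
  have "log_int M f' = log_int M f"
    unfolding log_int_def using assms(3) by (intro nn_integral_cong_AE) auto
  then show ?thesis using assms by (simp add: log_integrable_def)
qed

lemma log_integrable_add:
  fixes f g :: "'a \<Rightarrow> 'k::{real_normed_field, second_countable_topology}"
  assumes "log_integrable M f" "log_integrable M g"
  shows "log_integrable M (\<lambda>x. f x + g x)"
proof -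
  have m[measurable]: "f \<in> borel_measurable M" "g \<in> borel_measurable M"
    using assms by (auto simp: log_integrable_def)
  have "L0_add M (ae_eq M `` {f}) (ae_eq M `` {g}) \<in> L_log M"
    using assms m by (intro L0_add_in_L_log) (simp_all add: log_integrable_iff_class)
  then show ?thesis
    by (simp add: L0_add_class log_integrable_iff_class)
qed

lemma log_integrable_scale:
  fixes f :: "'a \<Rightarrow> 'k::{real_normed_field, second_countable_topology}"
  assumes "finite_measure M" "log_integrable M f"
  shows "log_integrable M (\<lambda>x. c * f x)"
proof -
  have m[measurable]: "f \<in> borel_measurable M"
    using assms by (auto simp: log_integrable_def)
  have "L0_scale M c (ae_eq M `` {f}) \<in> L_log M"
    using assms m by (intro L0_scale_in_L_log) (simp_all add: log_integrable_iff_class)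
  then show ?thesis
    by (simp add: L0_scale_class log_integrable_iff_class)
qed

definition supp :: "'a measure \<Rightarrow> ('a \<Rightarrow> 'k::zero) \<Rightarrow> 'a set" where
  "supp M f = {x \<in> space M. f x \<noteq> 0}"

lemma supp_sets [measurable]:
  fixes f :: "'a \<Rightarrow> 'k::{real_normed_field, second_countable_topology}"
  assumes [measurable]: "f \<in> borel_measurable M"
  shows "supp M f \<in> sets M"
  unfolding supp_def by measurable

definition unimodular_on_supp :: "'a measure \<Rightarrow> ('a \<Rightarrow> 'k::real_normed_field) \<Rightarrow> bool" where
  "unimodular_on_supp M f \<longleftrightarrow> (AE x in M. f x = 0 \<or> norm (f x) = 1)"

lemma log_int_scale_unimodular:
  fixes f :: "'a \<Rightarrow> 'k::{real_normed_field, second_countable_topology}"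
  assumes [measurable]: "f \<in> borel_measurable M" and u: "unimodular_on_supp M f" and t: "t \<ge> 0"
  shows "log_int M (\<lambda>x. of_real t * f x) = ennreal (ln (1 + t)) * emeasure M (supp M f)"
proof -
  have "log_int M (\<lambda>x. of_real t * f x) = (\<integral>\<^sup>+x. ennreal (ln (1 + t)) * indicator (supp M f) x \<partial>M)"
    unfolding log_int_def
  proof (rule nn_integral_cong_AE)
    show "AE x in M. ennreal (ln (1 + norm (of_real t * f x))) = ennreal (ln (1 + t)) * indicator (supp M f) x"
      using u[unfolded unimodular_on_supp_def] AE_space
      by eventually_elim (use t in \<open>auto simp: supp_def norm_mult split: split_indicator\<close>)
  qed
  then show ?thesis
    by (simp add: nn_integral_cmult_indicator)
qed

lemma log_integrable_unimodular:
  fixes f :: "'a \<Rightarrow> 'k::{real_normed_field, second_countable_topology}"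
  assumes "finite_measure M" "f \<in> borel_measurable M" "unimodular_on_supp M f"
  shows "log_integrable M f"
proof -
  interpret finite_measure M by fact
  show ?thesis
    using log_int_scale_unimodular[OF assms(2,3), of 1] assms(2)
    by (simp add: log_integrable_def ennreal_mult_eq_top_iff less_top[symmetric])
qed

text \<open>The support of a sum lies in the union of the supports. If its measure is the sum of
  both measures, there is nothing left for the intersection.\<close>

lemma disjoint_if_supp_additive:
  fixes f g :: "'a \<Rightarrow> 'k::{real_normed_field, second_countable_topology}"
  assumes "finite_measure M"
    and [measurable]: "f \<in> borel_measurable M" "g \<in> borel_measurable M"
    and add: "emeasure M (supp M (\<lambda>x. f x + g x)) = emeasure M (supp M f) + emeasure M (supp M g)"
  shows "AE x in M. f x = 0 \<or> g x = 0"
proof -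
  interpret finite_measure M by fact
  let ?S = "supp M f" and ?T = "supp M g"
  have "measure M (supp M (\<lambda>x. f x + g x)) = measure M ?S + measure M ?T"
    using add by (simp add: emeasure_eq_measure flip: ennreal_plus)
  moreover have "measure M (supp M (\<lambda>x. f x + g x)) \<le> measure M (?S \<union> ?T)"
    by (rule finite_measure_mono) (auto simp: supp_def)
  moreover have "measure M (?S \<union> ?T) = measure M ?S + measure M (?T - ?S)"
    by (rule finite_measure_Union') auto
  moreover have "measure M (?T - ?S) = measure M ?T - measure M (?T \<inter> ?S)"
    by (rule finite_measure_Diff') auto
  ultimately have "measure M (?T \<inter> ?S) = 0"
    using measure_nonneg[of M "?T \<inter> ?S"] by linarith
  then have "?T \<inter> ?S \<in> null_sets M"
    by (auto simp: null_sets_def emeasure_eq_measure)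
  then have "AE x in M. x \<notin> ?T \<inter> ?S"
    by (rule AE_not_in)
  then show ?thesis
    using AE_space by eventually_elim (auto simp: supp_def)
qed

lemma supp_add_disjoint:
  fixes f g :: "'a \<Rightarrow> 'k::{real_normed_field, second_countable_topology}"
  assumes [measurable]: "f \<in> borel_measurable M" "g \<in> borel_measurable M"
    and d: "AE x in M. f x = 0 \<or> g x = 0"
  shows "emeasure M (supp M (\<lambda>x. f x + g x)) = emeasure M (supp M f) + emeasure M (supp M g)"
proof (rule emeasure_add_AE)
  show "AE x in M. \<not> (x \<in> supp M f \<and> x \<in> supp M g)"
    using d by eventually_elim (auto simp: supp_def)
  show "AE x in M. x \<in> supp M (\<lambda>x. f x + g x) \<longleftrightarrow> x \<in> supp M f \<or> x \<in> supp M g"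
    using d by eventually_elim (auto simp: supp_def)
qed auto

section \<open>Functions with the logarithmic moments of an indicator\<close>

text \<open>The concave function \<open>ln (1 + a)\<close> lies below its tangent at \<open>a = 1\<close>, with contact only there.\<close>

lemma log_tangent_gap:
  fixes a :: real
  assumes "a \<ge> 0"
  shows "ln (1 + a) \<le> ln 2 + (a - 1) / 2"
    and "ln (1 + a) = ln 2 + (a - 1) / 2 \<Longrightarrow> a = 1"
proof -
  have *: "ln ((1 + a) / 2) = ln (1 + a) - ln 2"
    using assms by (subst ln_div) auto
  show "ln (1 + a) \<le> ln 2 + (a - 1) / 2"
    using ln_le_minus_one[of "(1 + a) / 2"] assms * by (simp add: field_simps)
  assume "ln (1 + a) = ln 2 + (a - 1) / 2"
  then have "ln ((1 + a) / 2) = (1 + a) / 2 - 1"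
    unfolding * by (simp add: field_simps)
  then show "a = 1"
    using ln_eq_minus_one[of "(1 + a) / 2"] assms by simp
qed

text \<open>Dividing the moments by \<open>t\<close> and letting \<open>t \<rightarrow> 0\<close>, Fatou's lemma gives \<open>\<integral> a \<le> m\<close>; dividing them by
  \<open>ln (1 + t)\<close> and letting \<open>t \<rightarrow> \<infinity>\<close>, it gives \<open>\<mu> S \<le> m\<close> for the support \<open>S\<close> of \<open>a\<close>. Integrating the
  tangent inequality \<open>log_tangent_gap\<close> over \<open>S\<close> bounds the moment at \<open>t = 1\<close> from above by
  \<open>(ln 2 - 1/2) \<mu> S + 1/2 \<integral> a \<le> m ln 2\<close>. As this moment equals \<open>m ln 2\<close>, the tangent inequality is an
  equality almost everywhere on \<open>S\<close>, which forces \<open>a = 1\<close> there.\<close>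

lemma log_moments_of_indicator:
  fixes a :: "'a \<Rightarrow> real"
  assumes "finite_measure M"
    and [measurable]: "a \<in> borel_measurable M" and nn: "\<And>x. a x \<ge> 0" and m: "m \<ge> 0"
    and moments: "\<And>t. t > 0 \<Longrightarrow> (\<integral>\<^sup>+x. ennreal (ln (1 + t * a x)) \<partial>M) = ennreal (m * ln (1 + t))"
  shows "AE x in M. a x = 0 \<or> a x = 1" and "emeasure M {x \<in> space M. a x \<noteq> 0} = ennreal m"
proof -
  interpret finite_measure M by fact
  define S where "S = {x \<in> space M. a x \<noteq> 0}"
  have [measurable]: "S \<in> sets M" unfolding S_def by measurable
  \<comment> \<open>Both limits in \<open>t\<close> are instances: the moment at \<open>t = s n\<close> is scaled by \<open>c n\<close>.\<close>
  have fatou: "(\<integral>\<^sup>+x. ennreal (v x) \<partial>M) \<le> ennreal m"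
    if c: "\<And>n. c n \<ge> 0" and s: "\<And>n. s n > 0" and le: "\<And>n. c n * ln (1 + s n) \<le> 1"
      and lim: "\<And>x. x \<in> space M \<Longrightarrow> (\<lambda>n. c n * ln (1 + s n * a x)) \<longlonglongrightarrow> v x"
    for c s :: "nat \<Rightarrow> real" and v
  proof -
    let ?u = "\<lambda>n x. ennreal (c n * ln (1 + s n * a x))"
    have "(\<integral>\<^sup>+x. ennreal (v x) \<partial>M) = (\<integral>\<^sup>+x. liminf (\<lambda>n. ?u n x) \<partial>M)"
      by (intro nn_integral_cong lim_imp_Liminf[symmetric] tendsto_ennrealI lim) auto
    also have "\<dots> \<le> liminf (\<lambda>n. \<integral>\<^sup>+x. ?u n x \<partial>M)"
      by (rule nn_integral_liminf) measurable
    also have "\<dots> \<le> ennreal m"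
    proof (rule Liminf_le)
      have "(\<integral>\<^sup>+x. ?u n x \<partial>M) \<le> ennreal m" for n
      proof -
        have "(\<integral>\<^sup>+x. ?u n x \<partial>M) = (\<integral>\<^sup>+x. ennreal (c n) * ennreal (ln (1 + s n * a x)) \<partial>M)"
          using c by (intro nn_integral_cong) (simp add: ennreal_mult')
        also have "\<dots> = ennreal (c n) * (\<integral>\<^sup>+x. ennreal (ln (1 + s n * a x)) \<partial>M)"
          by (rule nn_integral_cmult) measurable
        also have "\<dots> = ennreal (c n) * ennreal (m * ln (1 + s n))"
          by (simp add: moments s)
        also have "\<dots> = ennreal (m * (c n * ln (1 + s n)))"
          using c by (simp add: ennreal_mult' [symmetric] ac_simps)
        also have "\<dots> \<le> ennreal m"
          using m le by (intro ennreal_leI) (rule mult_left_le)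
        finally show ?thesis .
      qed
      then show "\<forall>\<^sub>F n in sequentially. (\<integral>\<^sup>+x. ?u n x \<partial>M) \<le> ennreal m" by simp
    qed simp
    finally show ?thesis .
  qed

  have int_le: "(\<integral>\<^sup>+x. ennreal (a x) \<partial>M) \<le> ennreal m"
  proof (rule fatou[where c = "\<lambda>n. real n" and s = "\<lambda>n. 1 / (real n + 1)"])
    show "real n * ln (1 + 1 / (real n + 1)) \<le> 1" for n
    proof -
      have "ln (1 + 1 / (real n + 1)) \<le> 1 / (real n + 1)"
        by (rule ln_add_one_self_le_self) simp
      then have "real n * ln (1 + 1 / (real n + 1)) \<le> real n * (1 / (real n + 1))"
        by (rule mult_left_mono) simp
      also have "\<dots> \<le> 1" by (simp add: field_simps)
      finally show ?thesis .
    qed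
    show "(\<lambda>n. real n * ln (1 + 1 / (real n + 1) * a x)) \<longlonglongrightarrow> a x" for x
      by (cases "a x = 0") (use nn[of x] in \<open>simp, real_asymp\<close>)
  qed auto

  have S_le: "emeasure M S \<le> ennreal m"
  proof -
    have "(\<integral>\<^sup>+x. ennreal (indicator S x) \<partial>M) \<le> ennreal m"
    proof (rule fatou[where c = "\<lambda>n. 1 / ln (real n + 2)" and s = "\<lambda>n. real n + 1"])
      show "(\<lambda>n. 1 / ln (real n + 2) * ln (1 + (real n + 1) * a x)) \<longlonglongrightarrow> indicator S x"
        if "x \<in> space M" for x
      proof (cases "a x = 0")
        case True
        then show ?thesis by (simp add: S_def)
      next
        case False
        then have "a x > 0" using nn[of x] by simp
        then have "(\<lambda>n. 1 / ln (real n + 2) * ln (1 + (real n + 1) * a x)) \<longlonglongrightarrow> 1"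
          by real_asymp
        then show ?thesis using False that by (simp add: S_def)
      qed
    qed (auto simp: add.commute)
    then show ?thesis by (simp add: ennreal_indicator)
  qed

  have int_a: "integrable M a"
    using int_le nn by (intro integrableI_nonneg) (auto simp: less_top[symmetric] top_unique)
  have a_le: "(\<integral>x. a x \<partial>M) \<le> m"
    using int_le nn m by (simp add: nn_integral_eq_integral[OF int_a])
  have ln_eq: "(\<integral>\<^sup>+x. ennreal (ln (1 + a x)) \<partial>M) = ennreal (m * ln 2)"
    using moments[of 1] by simp
  have int_ln: "integrable M (\<lambda>x. ln (1 + a x))"
    using ln_eq nn by (intro integrableI_nonneg) auto
  have L: "(\<integral>x. ln (1 + a x) \<partial>M) = m * ln 2"
    using ln_eq nn m by (intro integral_eq_nn_integral[THEN trans]) auto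
  have mS: "measure M S \<le> m"
    using S_le m by (simp add: emeasure_eq_measure)

  \<comment> \<open>The gap between tangent and logarithm, extended by zero outside \<open>S\<close>. Its integral is at most
    zero; here both upper bounds are used with positive coefficients, as \<open>ln 2 > 1/2\<close>.\<close>
  define d where "d x = (ln 2 - 1 / 2) * indicator S x + a x / 2 - ln (1 + a x)" for x
  have d_nn: "AE x in M. d x \<ge> 0"
    using AE_space
  proof eventually_elim
    case (elim x)
    then show ?case
      using log_tangent_gap(1)[OF nn[of x]] by (auto simp: d_def S_def field_simps split: split_indicator)
  qed
  have int_d: "integrable M d"
    unfolding d_def using int_a int_ln by (intro Bochner_Integration.integrable_diff Bochner_Integration.integrable_add) (auto simp: less_top[symmetric])
  have "(\<integral>x. d x \<partial>M) = (ln 2 - 1 / 2) * measure M S + (\<integral>x. a x \<partial>M) / 2 - m * ln 2"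
    unfolding d_def using int_a int_ln
    by (subst Bochner_Integration.integral_diff Bochner_Integration.integral_add; (simp add: L less_top[symmetric])?)+
  also have "\<dots> \<le> (ln 2 - 1 / 2) * m + m / 2 - m * ln 2"
    using a_le mS ln2_ge_two_thirds by (intro diff_right_mono add_mono mult_left_mono) auto
  also have "\<dots> = 0" by (simp add: algebra_simps)
  finally have "(\<integral>x. d x \<partial>M) = 0"
    using integral_nonneg_AE[OF d_nn] by linarith
  then have "AE x in M. d x = 0"
    using integral_nonneg_eq_0_iff_AE[OF int_d d_nn] by simp
  then show zo: "AE x in M. a x = 0 \<or> a x = 1"
    using AE_space
  proof eventually_elim
    case (elim x)
    then show ?case
      using log_tangent_gap(2)[OF nn[of x]] by (auto simp: d_def S_def field_simps split: split_indicator_asm)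
  qed
  have "(\<integral>\<^sup>+x. ennreal (ln (1 + a x)) \<partial>M) = (\<integral>\<^sup>+x. ennreal (ln 2) * indicator S x \<partial>M)"
  proof (rule nn_integral_cong_AE)
    show "AE x in M. ennreal (ln (1 + a x)) = ennreal (ln 2) * indicator S x"
      using zo AE_space by eventually_elim (auto simp: S_def split: split_indicator)
  qed
  also have "\<dots> = ennreal (ln 2) * emeasure M S"
    by (rule nn_integral_cmult_indicator) simp
  finally have "ennreal (m * ln 2) = ennreal (measure M S * ln 2)"
    unfolding ln_eq by (simp add: emeasure_eq_measure ennreal_mult' mult.commute)
  then have "m = measure M S"
    using m by (subst (asm) ennreal_inj) auto
  then show "emeasure M {x \<in> space M. a x \<noteq> 0} = ennreal m"
    by (simp add: emeasure_eq_measure S_def)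
qed

section \<open>Isometries as relations between functions\<close>

text \<open>\<open>W f g\<close> stands for \<open>U [f] = [g]\<close> with a surjective linear isometry \<open>U\<close>. The axioms are invariant
  under exchanging the two sides; that \<open>U\<close> is single-valued and injective is a consequence, see
  \<open>unique_right\<close> and \<open>unique_left\<close>.\<close>

locale log_isometric_relation =
  fixes M :: "'a measure" and N :: "'b measure"
    and W :: "('a \<Rightarrow> 'k::{real_normed_field, second_countable_topology}) \<Rightarrow> ('b \<Rightarrow> 'k) \<Rightarrow> bool"
  assumes finite_M: "finite_measure M" and finite_N: "finite_measure N"
    and integrable_left: "W f g \<Longrightarrow> log_integrable M f"
    and integrable_right: "W f g \<Longrightarrow> log_integrable N g"
    and left_total: "log_integrable M f \<Longrightarrow> \<exists>g. W f g"
    and right_total: "log_integrable N g \<Longrightarrow> \<exists>f. W f g"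
    and add: "W f g \<Longrightarrow> W f' g' \<Longrightarrow> W (\<lambda>x. f x + f' x) (\<lambda>y. g y + g' y)"
    and scale: "W f g \<Longrightarrow> W (\<lambda>x. c * f x) (\<lambda>y. c * g y)"
    and isometric: "W f g \<Longrightarrow> log_int N g = log_int M f"
    and AE_closed: "W f g \<Longrightarrow> f' \<in> borel_measurable M \<Longrightarrow> g' \<in> borel_measurable N \<Longrightarrow>
      AE x in M. f x = f' x \<Longrightarrow> AE y in N. g y = g' y \<Longrightarrow> W f' g'"
begin

lemma converse: "log_isometric_relation N M (\<lambda>g f. W f g)"
proof (rule log_isometric_relation.intro, goal_cases)
  case (3 f g) then show ?case by (rule integrable_right)
next
  case (4 f g) then show ?case by (rule integrable_left)
next
  case (5 f) then show ?case by (rule right_total)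
next
  case (6 g) then show ?case by (rule left_total)
next
  case (7 f g f' g') then show ?case by (rule add)
next
  case (8 f g c) then show ?case by (rule scale)
next
  case (9 f g) then show ?case by (rule isometric[symmetric])
next
  case (10 f g f' g')
  show ?case by (rule AE_closed[OF 10(1,3,2,5,4)])
qed (rule finite_M finite_N)+

lemma meas_left: "W f g \<Longrightarrow> f \<in> borel_measurable M"
  using integrable_left by (auto simp: log_integrable_def)

lemma meas_right: "W f g \<Longrightarrow> g \<in> borel_measurable N"
  using integrable_right by (auto simp: log_integrable_def)

text \<open>By homogeneity, all logarithmic moments of \<open>\<bar>g\<bar>\<close> agree with those of the indicator of the support
  of \<open>f\<close>.\<close>

lemma unimodular_on_supp_transfer:
  assumes W: "W f g" and u: "unimodular_on_supp M f"
  shows "unimodular_on_supp N g" and "emeasure N (supp N g) = emeasure M (supp M f)"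
proof -
  interpret M: finite_measure M by (rule finite_M)
  note [measurable] = meas_left[OF W] meas_right[OF W]
  have moments: "(\<integral>\<^sup>+y. ennreal (ln (1 + t * norm (g y))) \<partial>N) = ennreal (measure M (supp M f) * ln (1 + t))"
    if "t > 0" for t
  proof -
    have "(\<integral>\<^sup>+y. ennreal (ln (1 + t * norm (g y))) \<partial>N) = log_int N (\<lambda>y. of_real t * g y)"
      using that by (simp add: log_int_def norm_mult)
    also have "\<dots> = log_int M (\<lambda>x. of_real t * f x)"
      by (rule isometric[OF scale[OF W]])
    also have "\<dots> = ennreal (ln (1 + t)) * emeasure M (supp M f)"
      using u that by (intro log_int_scale_unimodular) auto
    finally show ?thesis
      using that by (simp add: M.emeasure_eq_measure ennreal_mult' mult.commute)
  qed
  have "AE y in N. norm (g y) = 0 \<or> norm (g y) = 1"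
    by (rule log_moments_of_indicator(1)[OF finite_N _ _ _ moments]) auto
  then show "unimodular_on_supp N g" by (simp add: unimodular_on_supp_def)
  have "emeasure N {y \<in> space N. norm (g y) \<noteq> 0} = ennreal (measure M (supp M f))"
    by (rule log_moments_of_indicator(2)[OF finite_N _ _ _ moments]) auto
  then show "emeasure N (supp N g) = emeasure M (supp M f)"
    by (simp add: supp_def M.emeasure_eq_measure)
qed

text \<open>Zero is unimodular on its empty support, so \<open>g - g'\<close>, a partner of \<open>f - f = 0\<close>, has a support of
  measure zero.\<close>

lemma unique_right:
  assumes "W f g" "W f g'"
  shows "AE y in N. g y = g' y"
proof -
  note [measurable] = meas_right[OF assms(1)] meas_right[OF assms(2)]
  have W: "W (\<lambda>x. f x + (- 1) * f x) (\<lambda>y. g y + (- 1) * g' y)"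
    using add[OF assms(1) scale[OF assms(2), where c = "- 1"]] .
  have "emeasure N (supp N (\<lambda>y. g y + (- 1) * g' y)) = emeasure M (supp M (\<lambda>x. f x + (- 1) * f x))"
    using unimodular_on_supp_transfer(2)[OF W] by (simp add: unimodular_on_supp_def)
  also have "\<dots> = 0" by (simp add: supp_def)
  finally have "supp N (\<lambda>y. g y + (- 1) * g' y) \<in> null_sets N"
    by (auto simp: null_sets_def)
  then have "AE y in N. y \<notin> supp N (\<lambda>y. g y + (- 1) * g' y)"
    by (rule AE_not_in)
  then show ?thesis
    using AE_space by eventually_elim (simp add: supp_def)
qed

lemma unique_left:
  assumes "W f g" "W f' g"
  shows "AE x in M. f x = f' x"
  by (rule log_isometric_relation.unique_right[OF converse, OF assms])

text \<open>The sum of the two left functions is unimodular on its support, so three support measures are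
  preserved; their additivity passes to the right.\<close>

lemma disjoint_transfer:
  assumes W: "W f g" "W f' g'"
    and u: "unimodular_on_supp M f" "unimodular_on_supp M f'"
    and d: "AE x in M. f x = 0 \<or> f' x = 0"
  shows "AE y in N. g y = 0 \<or> g' y = 0"
proof (rule disjoint_if_supp_additive[OF finite_N])
  note [measurable] = meas_left[OF W(1)] meas_left[OF W(2)]
  have "unimodular_on_supp M (\<lambda>x. f x + f' x)"
    unfolding unimodular_on_supp_def
    using d u[unfolded unimodular_on_supp_def] by eventually_elim auto
  then have "emeasure N (supp N (\<lambda>y. g y + g' y)) = emeasure M (supp M (\<lambda>x. f x + f' x))"
    by (rule unimodular_on_supp_transfer(2)[OF add[OF W]])
  also have "\<dots> = emeasure M (supp M f) + emeasure M (supp M f')"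
    using d by (rule supp_add_disjoint[rotated 2]) auto
  finally show "emeasure N (supp N (\<lambda>y. g y + g' y)) = emeasure N (supp N g) + emeasure N (supp N g')"
    by (simp add: unimodular_on_supp_transfer(2)[OF W(1) u(1)] unimodular_on_supp_transfer(2)[OF W(2) u(2)])
qed (use meas_right[OF W(1)] meas_right[OF W(2)] in auto)

end

section \<open>The set relation of an isometry\<close>

text \<open>\<open>P A B\<close> stands for \<open>\<phi> [A] = [B]\<close> with a measure preserving Boolean isomorphism \<open>\<phi>\<close>.\<close>

locale measure_algebra_relation =
  fixes M :: "'a measure" and N :: "'b measure" and P :: "'a set \<Rightarrow> 'b set \<Rightarrow> bool"
  assumes finite_M: "finite_measure M" and finite_N: "finite_measure N"
    and sets_left: "P A B \<Longrightarrow> A \<in> sets M"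
    and sets_right: "P A B \<Longrightarrow> B \<in> sets N"
    and left_total: "A \<in> sets M \<Longrightarrow> \<exists>B. P A B"
    and right_total: "B \<in> sets N \<Longrightarrow> \<exists>A. P A B"
    and Int: "P A B \<Longrightarrow> P A' B' \<Longrightarrow> P (A \<inter> A') (B \<inter> B')"
    and Compl: "P A B \<Longrightarrow> P (space M - A) (space N - B)"
    and measure_preserving: "P A B \<Longrightarrow> emeasure N B = emeasure M A"
    and AE_closed: "P A B \<Longrightarrow> A' \<in> sets M \<Longrightarrow> B' \<in> sets N \<Longrightarrow>
      AE x in M. x \<in> A \<longleftrightarrow> x \<in> A' \<Longrightarrow> AE y in N. y \<in> B \<longleftrightarrow> y \<in> B' \<Longrightarrow> P A' B'"

context log_isometric_relation
begin

definition supp_relation :: "'a set \<Rightarrow> 'b set \<Rightarrow> bool" where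
  "supp_relation A B \<longleftrightarrow> A \<in> sets M \<and> B \<in> sets N \<and>
     (\<exists>g. W (indicator A) g \<and> (AE y in N. y \<in> B \<longleftrightarrow> g y \<noteq> 0))"

lemma supp_indicator:
  assumes "A \<in> sets L"
  shows "supp L (indicator A :: _ \<Rightarrow> 'k) = A"
  using sets.sets_into_space[OF assms] by (auto simp: supp_def indicator_eq_0_iff)

lemma unimodular_indicator: "unimodular_on_supp L (indicator A :: _ \<Rightarrow> 'k)"
  by (auto simp: unimodular_on_supp_def split: split_indicator)

lemma indicator_related:
  assumes "A \<in> sets M"
  obtains g where "W (indicator A) g"
  using left_total[of "indicator A"] log_integrable_unimodular[OF finite_M _ unimodular_indicator] assms
  by (metis borel_measurable_indicator)

text \<open>Comparing supports of \<open>1\<close> and its partner in both directions shows that the spaces have the same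
  total measure. As the support of \<open>u\<close> has the measure of the left space, it is everything.\<close>

lemma indicator_space_full_support:
  assumes W: "W (indicator (space M)) u"
  shows "AE y in N. norm (u y) = 1"
proof -
  interpret N: finite_measure N by (rule finite_N)
  note [measurable] = meas_right[OF W]
  obtain f where f: "W f (indicator (space N))"
    by (rule log_isometric_relation.indicator_related[OF converse sets.top])
  have "emeasure N (space N) = emeasure M (supp M f)"
    using log_isometric_relation.unimodular_on_supp_transfer(2)[OF converse, OF f unimodular_indicator]
    by (simp add: supp_indicator)
  also have "\<dots> \<le> emeasure M (space M)"
    by (intro emeasure_mono) (auto simp: supp_def)
  also have "\<dots> = emeasure N (supp N u)"
    using unimodular_on_supp_transfer(2)[OF W unimodular_indicator] by (simp add: supp_indicator)
  finally have "emeasure N (space N - supp N u) = 0"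
    using emeasure_mono[of "supp N u" "space N" N]
    by (subst emeasure_Diff) (auto simp: supp_def N.emeasure_eq_measure)
  then have "space N - supp N u \<in> null_sets N"
    by (auto simp: null_sets_def)
  then have "AE y in N. y \<notin> space N - supp N u"
    by (rule AE_not_in)
  with unimodular_on_supp_transfer(1)[OF W unimodular_indicator, unfolded unimodular_on_supp_def] AE_space
  show ?thesis by eventually_elim (auto simp: supp_def)
qed

text \<open>The partners of two complementary indicators have disjoint supports, and their sum, a partner
  of \<open>1\<close>, vanishes almost nowhere.\<close>

lemma supp_relation_Compl:
  assumes "supp_relation A B"
  shows "supp_relation (space M - A) (space N - B)"
proof -
  from assms obtain g where s: "A \<in> sets M" "B \<in> sets N"
    and g: "W (indicator A) g" and B: "AE y in N. y \<in> B \<longleftrightarrow> g y \<noteq> 0"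
    unfolding supp_relation_def by blast
  obtain g' where g': "W (indicator (space M - A)) g'"
    using s by (meson indicator_related sets.compl_sets)
  have "(\<lambda>x. indicator A x + indicator (space M - A) x) = (indicator (space M) :: 'a \<Rightarrow> 'k)"
    using sets.sets_into_space[OF s(1)] by (auto simp: fun_eq_iff split: split_indicator)
  then have "W (indicator (space M)) (\<lambda>y. g y + g' y)"
    using add[OF g g'] by simp
  then have full: "AE y in N. norm (g y + g' y) = 1"
    by (rule indicator_space_full_support)
  have disj: "AE y in N. g y = 0 \<or> g' y = 0"
    by (rule disjoint_transfer[OF g g' unimodular_indicator unimodular_indicator])
      (auto split: split_indicator)
  have "AE y in N. y \<in> space N - B \<longleftrightarrow> g' y \<noteq> 0"
    using B full disj AE_space by eventually_elim auto
  with g' s show ?thesis by (auto simp: supp_relation_def)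
qed

text \<open>Split both sets along their intersection. The three pieces have partners \<open>c\<close>, \<open>d\<close>, \<open>e\<close> with
  disjoint supports, so \<open>c + d\<close> and \<open>c + e\<close> are both nonzero exactly where \<open>c\<close> is.\<close>

lemma supp_relation_Int:
  assumes "supp_relation A B" "supp_relation A' B'"
  shows "supp_relation (A \<inter> A') (B \<inter> B')"
proof -
  from assms obtain g g' where s: "A \<in> sets M" "B \<in> sets N" "A' \<in> sets M" "B' \<in> sets N"
    and g: "W (indicator A) g" "AE y in N. y \<in> B \<longleftrightarrow> g y \<noteq> 0"
    and g': "W (indicator A') g'" "AE y in N. y \<in> B' \<longleftrightarrow> g' y \<noteq> 0"
    unfolding supp_relation_def by blast
  obtain c where c: "W (indicator (A \<inter> A')) c" using s by (meson indicator_related sets.Int)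
  obtain d where d: "W (indicator (A - A')) d" using s by (meson indicator_related sets.Diff)
  obtain e where e: "W (indicator (A' - A)) e" using s by (meson indicator_related sets.Diff)
  have "(\<lambda>x. indicator (A \<inter> A') x + indicator (A - A') x) = (indicator A :: 'a \<Rightarrow> 'k)"
    by (auto simp: fun_eq_iff split: split_indicator)
  then have 1: "AE y in N. g y = c y + d y"
    using unique_right[OF g(1)] add[OF c d] by simp
  have "(\<lambda>x. indicator (A \<inter> A') x + indicator (A' - A) x) = (indicator A' :: 'a \<Rightarrow> 'k)"
    by (auto simp: fun_eq_iff split: split_indicator)
  then have 2: "AE y in N. g' y = c y + e y"
    using unique_right[OF g'(1)] add[OF c e] by simp
  note disj = disjoint_transfer[OF _ _ unimodular_indicator unimodular_indicator]
  have "AE y in N. c y = 0 \<or> d y = 0" "AE y in N. c y = 0 \<or> e y = 0" "AE y in N. d y = 0 \<or> e y = 0"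
    by (rule disj[OF c d] disj[OF c e] disj[OF d e]; auto split: split_indicator)+
  then have "AE y in N. y \<in> B \<inter> B' \<longleftrightarrow> c y \<noteq> 0"
    using g(2) g'(2) 1 2 by eventually_elim auto
  with c s show ?thesis by (auto simp: supp_relation_def)
qed

text \<open>Cut the partner \<open>u\<close> of \<open>1\<close> along \<open>B\<close>. The left partners of the two parts have disjoint supports
  and add up to \<open>1\<close>, so they are indicators.\<close>

lemma supp_relation_right_total:
  assumes B: "B \<in> sets N"
  shows "\<exists>A. supp_relation A B"
proof -
  obtain u where u: "W (indicator (space M)) u"
    by (rule indicator_related[OF sets.top])
  note [measurable] = meas_right[OF u] B
  have u1: "AE y in N. norm (u y) = 1" by (rule indicator_space_full_support[OF u])
  define g where "g y = u y * indicator B y" for y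
  define g' where "g' y = u y * indicator (space N - B) y" for y
  have [measurable]: "g \<in> borel_measurable N" "g' \<in> borel_measurable N"
    unfolding g_def g'_def by measurable
  have ug: "unimodular_on_supp N g" "unimodular_on_supp N g'"
    unfolding unimodular_on_supp_def
    using u1 by (eventually_elim, auto simp: g_def g'_def norm_mult split: split_indicator)+
  then obtain f f' where f: "W f g" "W f' g'"
    using right_total log_integrable_unimodular[OF finite_N] by (metis \<open>g \<in> _\<close> \<open>g' \<in> _\<close>)
  note [measurable] = meas_left[OF f(1)] meas_left[OF f(2)]
  have "AE x in M. f x = 0 \<or> f' x = 0"
    by (rule log_isometric_relation.disjoint_transfer[OF converse, OF f ug])
      (auto simp: g_def g'_def split: split_indicator)
  moreover have "W (\<lambda>x. f x + f' x) u"
  proof (rule AE_closed[OF add[OF f]])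
    show "AE y in N. g y + g' y = u y"
      using AE_space by eventually_elim (auto simp: g_def g'_def split: split_indicator)
  qed auto
  then have "AE x in M. f x + f' x = indicator (space M) x"
    using u by (rule unique_left)
  ultimately have "AE x in M. f x = indicator (supp M f) x"
    using AE_space by eventually_elim (auto simp: supp_def split: split_indicator)
  then have "W (indicator (supp M f)) g"
    by (intro AE_closed[OF f(1)]) auto
  moreover have "AE y in N. y \<in> B \<longleftrightarrow> g y \<noteq> 0"
    using u1 by eventually_elim (auto simp: g_def split: split_indicator)
  ultimately have "supp_relation (supp M f) B"
    unfolding supp_relation_def using B by (blast intro: supp_sets meas_left f)
  then show ?thesis by blast
qed

theorem supp_relation: "measure_algebra_relation M N supp_relation"
proof (rule measure_algebra_relation.intro, goal_cases)
  case (3 A B) then show ?case by (simp add: supp_relation_def)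
next
  case (4 A B) then show ?case by (simp add: supp_relation_def)
next
  case (5 A)
  then show ?case
  proof -
    assume A: "A \<in> sets M"
    obtain g where g: "W (indicator A) g" by (rule indicator_related[OF A])
    have "supp N g \<in> sets N" using meas_right[OF g] by measurable
    moreover have "AE y in N. y \<in> supp N g \<longleftrightarrow> g y \<noteq> 0"
      using AE_space by eventually_elim (auto simp: supp_def)
    ultimately show ?thesis using g A by (auto simp: supp_relation_def)
  qed
next
  case (6 B) then show ?case by (rule supp_relation_right_total)
next
  case (7 A B A' B') then show ?case by (rule supp_relation_Int)
next
  case (8 A B) then show ?case by (rule supp_relation_Compl)
next
  case (9 A B)
  then show ?case
  proof -
    assume "supp_relation A B"
    then obtain g where s: "A \<in> sets M" "B \<in> sets N"
      and g: "W (indicator A) g" and B: "AE y in N. y \<in> B \<longleftrightarrow> g y \<noteq> 0"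
      unfolding supp_relation_def by blast
    have "emeasure N B = emeasure N (supp N g)"
    proof (rule emeasure_eq_AE)
      show "AE y in N. y \<in> B \<longleftrightarrow> y \<in> supp N g"
        using B AE_space by eventually_elim (auto simp: supp_def)
    qed (use s meas_right[OF g] in auto)
    also have "\<dots> = emeasure M (supp M (indicator A :: 'a \<Rightarrow> 'k))"
      by (rule unimodular_on_supp_transfer(2)[OF g unimodular_indicator])
    also have "supp M (indicator A :: 'a \<Rightarrow> 'k) = A"
      by (rule supp_indicator[OF s(1)])
    finally show ?thesis .
  qed
next
  case (10 A B A' B')
  then show ?case
  proof -
    assume AB: "supp_relation A B" and s: "A' \<in> sets M" "B' \<in> sets N"
      and A: "AE x in M. x \<in> A \<longleftrightarrow> x \<in> A'" and B: "AE y in N. y \<in> B \<longleftrightarrow> y \<in> B'"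
    from AB obtain g where g: "W (indicator A) g" "AE y in N. y \<in> B \<longleftrightarrow> g y \<noteq> 0"
      unfolding supp_relation_def by blast
    have "AE x in M. (indicator A x :: 'k) = indicator A' x"
      using A by eventually_elim (auto split: split_indicator)
    then have "W (indicator A') g"
      using s meas_right[OF g(1)] by (intro AE_closed[OF g(1)]) auto
    moreover have "AE y in N. y \<in> B' \<longleftrightarrow> g y \<noteq> 0"
      using B g(2) by eventually_elim auto
    ultimately show ?thesis using s by (auto simp: supp_relation_def)
  qed
qed (rule finite_M finite_N)+

end

section \<open>Lifting a relation between sets to functions\<close>

context measure_algebra_relation
begin

lemma converse: "measure_algebra_relation N M (\<lambda>B A. P A B)"
proof (rule measure_algebra_relation.intro, goal_cases)
  case (3 A B) then show ?case by (rule sets_right)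
next
  case (4 A B) then show ?case by (rule sets_left)
next
  case (5 A) then show ?case by (rule right_total)
next
  case (6 B) then show ?case by (rule left_total)
next
  case (7 A B A' B') then show ?case by (rule Int)
next
  case (8 A B) then show ?case by (rule Compl)
next
  case (9 A B) then show ?case by (rule measure_preserving[symmetric])
next
  case (10 A B A' B')
  show ?case by (rule AE_closed[OF 10(1,3,2,5,4)])
qed (rule finite_M finite_N)+

lemma Diff:
  assumes "P A B" "P A' B'"
  shows "P (A - A') (B - B')"
proof -
  have "A - A' = A \<inter> (space M - A')" "B - B' = B \<inter> (space N - B')"
    using sets_left[OF assms(1), THEN sets.sets_into_space]
      sets_right[OF assms(1), THEN sets.sets_into_space] by auto
  then show ?thesis using Int[OF assms(1) Compl[OF assms(2)]] by simp
qed

lemma empty: "P {} {}"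
  using left_total[OF sets.top] Diff by (metis Diff_cancel)

lemma Un:
  assumes "P A B" "P A' B'"
  shows "P (A \<union> A') (B \<union> B')"
proof -
  have "A \<union> A' = space M - ((space M - A) - A')" "B \<union> B' = space N - ((space N - B) - B')"
    using assms[THEN sets_left, THEN sets.sets_into_space]
      assms[THEN sets_right, THEN sets.sets_into_space] by auto
  then show ?thesis using Compl[OF Diff[OF Compl[OF assms(1)] assms(2)]] by simp
qed

lemma null_sets_transfer:
  assumes "P A B" "A \<in> null_sets M"
  shows "B \<in> null_sets N"
  using assms measure_preserving[OF assms(1)] sets_right[OF assms(1)] by (auto simp: null_sets_def)

lemma unique_right:
  assumes "P A B" "P A B'"
  shows "AE y in N. y \<in> B \<longleftrightarrow> y \<in> B'"
proof -
  have "B - B' \<in> null_sets N" "B' - B \<in> null_sets N"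
    using Diff[OF assms] Diff[OF assms(2,1)] by (auto intro: null_sets_transfer)
  note this[THEN AE_not_in]
  then show ?thesis by eventually_elim auto
qed

lemma unique_left:
  assumes "P A B" "P A' B"
  shows "AE x in M. x \<in> A \<longleftrightarrow> x \<in> A'"
  by (rule measure_algebra_relation.unique_right[OF converse, OF assms])

text \<open>Finite unions are respected by the Boolean axioms. If \<open>C\<close> corresponds to the whole union, it
  contains each \<open>B n\<close> up to null sets, and what it has beyond the union of the \<open>B n\<close> is not larger
  than the parts of the union of the \<open>A n\<close> left over by finite subunions, whose measures tend to
  zero.\<close>

lemma UN_nat:
  fixes A :: "nat \<Rightarrow> 'a set"
  assumes P: "\<And>n. P (A n) (B n)"
  shows "P (\<Union>n. A n) (\<Union>n. B n)"
proof -
  interpret M: finite_measure M by (rule finite_M)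
  note [measurable] = sets_left[OF P] sets_right[OF P]
  obtain C where C: "P (\<Union>n. A n) C"
    using left_total[of "\<Union>n. A n"] by auto
  note [measurable] = sets_right[OF C]
  have partial: "P (\<Union>i<n. A i) (\<Union>i<n. B i)" for n
    by (induction n) (auto simp: lessThan_Suc intro: empty Un P)
  have "B n - C \<in> null_sets N" for n
  proof (rule null_sets_transfer[OF Diff[OF P C]])
    show "A n - (\<Union>n. A n) \<in> null_sets M" by (simp add: Diff_eq_empty_iff[THEN iffD2] UN_upper)
  qed
  then have BC: "AE y in N. y \<notin> B n - C" for n by (rule AE_not_in)
  have "emeasure N (C - (\<Union>n. B n)) = 0"
  proof -
    have "(\<lambda>n. emeasure M ((\<Union>n. A n) - (\<Union>i<n. A i))) \<longlonglongrightarrow> emeasure M (\<Inter>n. (\<Union>n. A n) - (\<Union>i<n. A i))"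
      by (rule Lim_emeasure_decseq) (auto simp: decseq_def M.emeasure_eq_measure)
    also have "(\<Inter>n. (\<Union>n. A n) - (\<Union>i<n. A i)) = {}"
      by (auto intro: lessI)
    finally have lim: "(\<lambda>n. emeasure M ((\<Union>n. A n) - (\<Union>i<n. A i))) \<longlonglongrightarrow> 0" by simp
    have "emeasure N (C - (\<Union>n. B n)) \<le> emeasure M ((\<Union>n. A n) - (\<Union>i<n. A i))" for n
      unfolding measure_preserving[OF Diff[OF C partial], symmetric]
      by (intro emeasure_mono) auto
    then have "emeasure N (C - (\<Union>n. B n)) \<le> 0"
      by (intro LIMSEQ_le_const[OF lim]) auto
    then show ?thesis by simp
  qed
  then have "C - (\<Union>n. B n) \<in> null_sets N" by (auto simp: null_sets_def)
  then have CB: "AE y in N. y \<notin> C - (\<Union>n. B n)" by (rule AE_not_in)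
  show ?thesis
  proof (rule AE_closed[OF C])
    have "AE y in N. \<forall>n. y \<notin> B n - C" unfolding AE_all_countable using BC by blast
    with CB show "AE y in N. y \<in> C \<longleftrightarrow> y \<in> (\<Union>n. B n)" by eventually_elim auto
  qed auto
qed

lemma UN:
  fixes A :: "'i::countable \<Rightarrow> 'a set"
  assumes P: "\<And>i. P (A i) (B i)"
  shows "P (\<Union>i. A i) (\<Union>i. B i)"
proof -
  have "(\<Union>i. A i) = (\<Union>n. A (from_nat n))" "(\<Union>i. B i) = (\<Union>n. B (from_nat n))"
    using surj_from_nat by (metis image_image)+
  then show ?thesis using UN_nat[of "\<lambda>n. A (from_nat n)" "\<lambda>n. B (from_nat n)"] P by simp
qed

definition preimages_related :: "('a \<Rightarrow> 'c::topological_space) \<Rightarrow> ('b \<Rightarrow> 'c) \<Rightarrow> bool" where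
  "preimages_related f g \<longleftrightarrow> f \<in> borel_measurable M \<and> g \<in> borel_measurable N \<and>
     (\<forall>X\<in>sets borel. P (f -` X \<inter> space M) (g -` X \<inter> space N))"

text \<open>The Borel sets with corresponding preimages form a \<open>\<sigma>\<close>-algebra.\<close>

lemma preimages_related_generator:
  fixes f :: "'a \<Rightarrow> 'c::topological_space"
  assumes [measurable]: "f \<in> borel_measurable M" "g \<in> borel_measurable N"
    and borel: "sets (borel :: 'c measure) = sigma_sets UNIV G"
    and G: "\<And>X. X \<in> G \<Longrightarrow> P (f -` X \<inter> space M) (g -` X \<inter> space N)"
  shows "preimages_related f g"
proof -
  have "P (f -` X \<inter> space M) (g -` X \<inter> space N)" if "X \<in> sigma_sets UNIV G" for X
    using that
  proof induction
    case (Basic X) then show ?case by (rule G)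
  next
    case Empty show ?case using empty by simp
  next
    case (Compl X)
    have "f -` (UNIV - X) \<inter> space M = space M - (f -` X \<inter> space M)"
      "g -` (UNIV - X) \<inter> space N = space N - (g -` X \<inter> space N)" by auto
    with measure_algebra_relation.Compl[OF measure_algebra_relation_axioms Compl.IH] show ?case by simp
  next
    case (Union X)
    have "f -` \<Union>(range X) \<inter> space M = (\<Union>n. f -` X n \<inter> space M)"
      "g -` \<Union>(range X) \<inter> space N = (\<Union>n. g -` X n \<inter> space N)" by auto
    with UN_nat[OF Union.IH] show ?case by simp
  qed
  then show ?thesis using borel by (auto simp: preimages_related_def)
qed

lemma preimages_related_comp:
  assumes R: "preimages_related f g" and [measurable]: "h \<in> borel_measurable borel"
  shows "preimages_related (\<lambda>x. h (f x)) (\<lambda>y. h (g y))"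
  unfolding preimages_related_def
proof (intro conjI ballI)
  have [measurable]: "f \<in> borel_measurable M" "g \<in> borel_measurable N"
    using R by (auto simp: preimages_related_def)
  show "(\<lambda>x. h (f x)) \<in> borel_measurable M" "(\<lambda>y. h (g y)) \<in> borel_measurable N"
    by measurable
  fix X :: "'d set" assume "X \<in> sets borel"
  then have "h -` X \<in> sets borel"
    using measurable_sets[OF assms(2)] by simp
  then have "P (f -` (h -` X) \<inter> space M) (g -` (h -` X) \<inter> space N)"
    using R by (auto simp: preimages_related_def)
  then show "P ((\<lambda>x. h (f x)) -` X \<inter> space M) ((\<lambda>y. h (g y)) -` X \<inter> space N)"
    by (simp add: vimage_def)
qed

lemma preimages_related_Pair:
  fixes f :: "'a \<Rightarrow> 'c::second_countable_topology" and f' :: "'a \<Rightarrow> 'd::second_countable_topology"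
  assumes R: "preimages_related f g" "preimages_related f' g'"
  shows "preimages_related (\<lambda>x. (f x, f' x)) (\<lambda>y. (g y, g' y))"
proof (rule preimages_related_generator)
  have [measurable]: "f \<in> borel_measurable M" "g \<in> borel_measurable N"
    "f' \<in> borel_measurable M" "g' \<in> borel_measurable N"
    using R by (auto simp: preimages_related_def)
  show "(\<lambda>x. (f x, f' x)) \<in> borel_measurable M" "(\<lambda>y. (g y, g' y)) \<in> borel_measurable N"
    by measurable
  show "sets (borel :: ('c \<times> 'd) measure) = sigma_sets UNIV {X \<times> Y | X Y. X \<in> sets borel \<and> Y \<in> sets borel}"
    unfolding borel_prod[symmetric] sets_pair_measure by simp
  fix Z assume "Z \<in> {X \<times> Y | X Y. X \<in> sets (borel :: 'c measure) \<and> Y \<in> sets (borel :: 'd measure)}"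
  then obtain X Y where Z: "Z = X \<times> Y" and XY: "X \<in> sets borel" "Y \<in> sets borel" by auto
  have "P ((f -` X \<inter> space M) \<inter> (f' -` Y \<inter> space M)) ((g -` X \<inter> space N) \<inter> (g' -` Y \<inter> space N))"
    using R XY unfolding preimages_related_def by (intro Int[where A = "f -` X \<inter> space M"]) blast+
  also have "(f -` X \<inter> space M) \<inter> (f' -` Y \<inter> space M) = (\<lambda>x. (f x, f' x)) -` Z \<inter> space M"
    by (auto simp: Z)
  also have "(g -` X \<inter> space N) \<inter> (g' -` Y \<inter> space N) = (\<lambda>y. (g y, g' y)) -` Z \<inter> space N"
    by (auto simp: Z)
  finally show "P ((\<lambda>x. (f x, f' x)) -` Z \<inter> space M) ((\<lambda>y. (g y, g' y)) -` Z \<inter> space N)" .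
qed

lemma preimages_related_add:
  fixes f :: "'a \<Rightarrow> 'c::{second_countable_topology, topological_monoid_add}"
  assumes "preimages_related f g" "preimages_related f' g'"
  shows "preimages_related (\<lambda>x. f x + f' x) (\<lambda>y. g y + g' y)"
  using preimages_related_comp[OF preimages_related_Pair[OF assms], of "\<lambda>(u, v). u + v"]
  by (simp add: borel_measurable_continuous_onI continuous_on_add continuous_on_fst continuous_on_snd split_beta)

lemma preimages_related_AE_closed:
  assumes R: "preimages_related f g" and m: "f' \<in> borel_measurable M" "g' \<in> borel_measurable N"
    and f: "AE x in M. f x = f' x" and g: "AE y in N. g y = g' y"
  shows "preimages_related f' g'"
  unfolding preimages_related_def
proof (intro conjI ballI m)
  fix X :: "'c set" assume X: "X \<in> sets borel"
  show "P (f' -` X \<inter> space M) (g' -` X \<inter> space N)"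
  proof (rule AE_closed)
    show "P (f -` X \<inter> space M) (g -` X \<inter> space N)"
      using R X by (simp add: preimages_related_def)
    show "AE x in M. (x \<in> f -` X \<inter> space M) = (x \<in> f' -` X \<inter> space M)"
      using f by eventually_elim auto
    show "AE y in N. (y \<in> g -` X \<inter> space N) = (y \<in> g' -` X \<inter> space N)"
      using g by eventually_elim auto
  qed (use X m in \<open>auto intro: measurable_sets\<close>)
qed

text \<open>For each rational \<open>q\<close> choose a set \<open>B q\<close> corresponding to the sublevel set of \<open>f\<close> at \<open>q\<close>. The
  extended real function \<open>e y\<close>, the infimum of the \<open>q\<close> with \<open>y \<in> B q\<close>, satisfies \<open>e y < r\<close> iff \<open>y\<close>
  is in some \<open>B q\<close> with \<open>q < r\<close>. Its sublevel sets are thus countable unions of chosen sets and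
  correspond to those of \<open>f\<close>. It is finite almost everywhere, because the sets where
  it is infinite correspond to the empty sets where \<open>f\<close> would be.\<close>

lemma preimages_related_real_total:
  fixes f :: "'a \<Rightarrow> real"
  assumes [measurable]: "f \<in> borel_measurable M"
  shows "\<exists>g. preimages_related f g"
proof -
  let ?L = "\<lambda>r. {x \<in> space M. f x < r}"
  have "\<forall>q::rat. \<exists>B. P (?L (of_rat q)) B"
    by (intro allI left_total) measurable
  then obtain B where B: "\<And>q::rat. P (?L (of_rat q)) (B q)" by metis
  note [measurable] = sets_right[OF B]
  define e where "e y = (INF q. if y \<in> B q then ereal (of_rat q) else \<infinity>)" for y
  have [measurable]: "e \<in> borel_measurable N"
    unfolding e_def by measurable
  have e_less: "e y < ereal r \<longleftrightarrow> (\<exists>q. of_rat q < r \<and> y \<in> B q)" for y r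
    unfolding e_def INF_less_iff by (auto split: if_splits)
  have P_less: "P (?L r) {y \<in> space N. e y < ereal r}" for r
  proof -
    have "P (if of_rat q < r then ?L (of_rat q) else {}) (if of_rat q < r then B q else {})" for q
      using B empty by simp
    then have "P (\<Union>q. if of_rat q < r then ?L (of_rat q) else {}) (\<Union>q. if of_rat q < r then B q else {})"
      by (rule UN)
    also have "(\<Union>q. if of_rat q < r then ?L (of_rat q) else {}) = ?L r"
      using of_rat_dense by (fastforce split: if_splits)
    also have "(\<Union>q. if of_rat q < r then B q else {}) = {y \<in> space N. e y < ereal r}"
      using sets_right[OF B, THEN sets.sets_into_space] by (auto simp: e_less split: if_splits)
    finally show ?thesis .
  qed
  have "P (\<Union>n::nat. ?L (real n)) (\<Union>n. {y \<in> space N. e y < ereal (real n)})"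
    by (intro UN P_less)
  then have "P (space M - (\<Union>n::nat. ?L (real n))) (space N - (\<Union>n. {y \<in> space N. e y < ereal (real n)}))"
    by (rule Compl)
  moreover have "space M - (\<Union>n::nat. ?L (real n)) \<in> null_sets M"
  proof -
    have "space M - (\<Union>n::nat. ?L (real n)) = {}"
      using reals_Archimedean2 by auto
    then show ?thesis by (metis null_sets.empty_sets)
  qed
  ultimately have "space N - (\<Union>n. {y \<in> space N. e y < ereal (real n)}) \<in> null_sets N"
    by (rule null_sets_transfer)
  then have 1: "AE y in N. y \<notin> space N - (\<Union>n. {y \<in> space N. e y < ereal (real n)})"
    by (rule AE_not_in)
  have "P (\<Union>n::nat. space M - ?L (- real n)) (\<Union>n. space N - {y \<in> space N. e y < ereal (- real n)})"
    by (intro UN Compl P_less)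
  then have "P (space M - (\<Union>n::nat. space M - ?L (- real n)))
      (space N - (\<Union>n. space N - {y \<in> space N. e y < ereal (- real n)}))"
    by (rule Compl)
  moreover have "space M - (\<Union>n::nat. space M - ?L (- real n)) \<in> null_sets M"
  proof -
    have "\<exists>n. - real n \<le> f x" for x
      using reals_Archimedean2[of "- f x"] by (metis less_imp_le minus_le_iff)
    then have "space M - (\<Union>n::nat. space M - ?L (- real n)) = {}"
      by (fastforce simp: not_less)
    then show ?thesis by (metis null_sets.empty_sets)
  qed
  ultimately have "space N - (\<Union>n. space N - {y \<in> space N. e y < ereal (- real n)}) \<in> null_sets N"
    by (rule null_sets_transfer)
  then have 2: "AE y in N. y \<notin> space N - (\<Union>n. space N - {y \<in> space N. e y < ereal (- real n)})"
    by (rule AE_not_in)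
  define g where "g y = real_of_ereal (e y)" for y
  have [measurable]: "g \<in> borel_measurable N" unfolding g_def by measurable
  have fin: "AE y in N. e y = ereal (g y)"
    using 1 2 AE_space
  proof eventually_elim
    case (elim y)
    then have "e y \<noteq> \<infinity>" "e y \<noteq> -\<infinity>" by auto
    then show ?case unfolding g_def by (cases "e y") auto
  qed
  have "preimages_related f g"
  proof (rule preimages_related_generator)
    show "sets (borel :: real measure) = sigma_sets UNIV (range lessThan)"
      by (subst borel_Iio) simp
    fix X :: "real set" assume "X \<in> range lessThan"
    then obtain r where X: "X = {..<r}" by auto
    have sx: "f -` X \<inter> space M = ?L r" "g -` X \<inter> space N = {y \<in> space N. g y < r}"
      by (auto simp: X)
    show "P (f -` X \<inter> space M) (g -` X \<inter> space N)"
      unfolding sx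
    proof (rule AE_closed[OF P_less[of r]])
      show "AE y in N. (y \<in> {y \<in> space N. e y < ereal r}) = (y \<in> {y \<in> space N. g y < r})"
        using fin by eventually_elim simp
    qed auto
  qed auto
  then show ?thesis by blast
qed

lemma preimages_related_total:
  fixes f :: "'a \<Rightarrow> 'k::euclidean_space"
  assumes [measurable]: "f \<in> borel_measurable M"
  shows "\<exists>g. preimages_related f g"
proof -
  have "\<exists>g. preimages_related (\<lambda>x. f x \<bullet> b) g" for b
    by (rule preimages_related_real_total) measurable
  then obtain g where g: "\<And>b. preimages_related (\<lambda>x. f x \<bullet> b) (g b)" by metis
  have sums: "preimages_related (\<lambda>x. \<Sum>b\<in>S. (f x \<bullet> b) *\<^sub>R b) (\<lambda>y. \<Sum>b\<in>S. g b y *\<^sub>R b)"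
    if "finite S" for S
    using that
  proof induction
    case empty
    show ?case
      using preimages_related_comp[OF g, of "\<lambda>_. 0"] by simp
  next
    case (insert b S)
    have "preimages_related (\<lambda>x. (f x \<bullet> b) *\<^sub>R b) (\<lambda>y. g b y *\<^sub>R b)"
      using preimages_related_comp[OF g[of b], of "\<lambda>r. r *\<^sub>R b"] by simp
    then show ?case
      using preimages_related_add[OF _ insert.IH] insert.hyps by simp
  qed
  show ?thesis
    using sums[of Basis] by (auto simp: euclidean_representation)
qed

lemma preimages_related_converse:
  "measure_algebra_relation.preimages_related N M (\<lambda>B A. P A B) g f \<longleftrightarrow> preimages_related f g"
  unfolding preimages_related_def measure_algebra_relation.preimages_related_def[OF converse] by blast

text \<open>Related functions have the same distribution.\<close>

lemma preimages_related_log_int: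
  fixes f :: "'a \<Rightarrow> 'k::{real_normed_field, second_countable_topology}"
  assumes R: "preimages_related f g"
  shows "log_int N g = log_int M f"
proof -
  have [measurable]: "f \<in> borel_measurable M" "g \<in> borel_measurable N"
    using R by (auto simp: preimages_related_def)
  have "distr N borel g = distr M borel f"
  proof (rule measure_eqI)
    fix X assume "X \<in> sets (distr N borel g)"
    then have X: "X \<in> sets borel" by simp
    then have "emeasure N (g -` X \<inter> space N) = emeasure M (f -` X \<inter> space M)"
      using R by (intro measure_preserving) (auto simp: preimages_related_def)
    then show "emeasure (distr N borel g) X = emeasure (distr M borel f) X"
      using X by (simp add: emeasure_distr)
  qed simp
  then have "(\<integral>\<^sup>+z. ennreal (ln (1 + norm z)) \<partial>distr N borel g) = (\<integral>\<^sup>+z. ennreal (ln (1 + norm z)) \<partial>distr M borel f)"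
    by simp
  then show ?thesis
    by (simp add: log_int_def nn_integral_distr)
qed

theorem log_isometric_preimages_related:
  "log_isometric_relation M N
     (\<lambda>f g :: 'b \<Rightarrow> 'k::{real_normed_field, euclidean_space}. log_integrable M f \<and> preimages_related f g)"
proof (rule log_isometric_relation.intro, goal_cases)
  case (3 f g) then show ?case by simp
next
  case (4 f g)
  then show ?case
    using preimages_related_log_int[of f g] by (auto simp: log_integrable_def preimages_related_def)
next
  case (5 f)
  then show ?case
    using preimages_related_total[of f] by (auto simp: log_integrable_def)
next
  case (6 g)
  then have "g \<in> borel_measurable N" by (simp add: log_integrable_def)
  then obtain f where f: "preimages_related f g"
    using measure_algebra_relation.preimages_related_total[OF converse] preimages_related_converse by blast
  then have "log_integrable M f"
    using 6 preimages_related_log_int[OF f] by (auto simp: log_integrable_def preimages_related_def)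
  with f show ?case by blast
next
  case (7 f g f' g')
  then show ?case by (auto intro: log_integrable_add preimages_related_add)
next
  case (8 f g c)
  then show ?case
    using preimages_related_comp[of f g "\<lambda>z. c * z"] by (auto intro: log_integrable_scale[OF finite_M])
next
  case (9 f g)
  then show ?case by (auto intro: preimages_related_log_int)
next
  case (10 f g f' g')
  then show ?case
    by (auto intro: log_integrable_cong_AE preimages_related_AE_closed)
qed (rule finite_M finite_N)+

end

section \<open>From relations to maps between classes and back\<close>

lemma log_isometric_relation_of_isometry:
  fixes U :: "('a \<Rightarrow> 'k::{real_normed_field, second_countable_topology}) set \<Rightarrow> ('b \<Rightarrow> 'k) set"
  assumes finite: "finite_measure M" "finite_measure N" and U: "L_log_isometry M N U"
  shows "log_isometric_relation M N
    (\<lambda>f g. log_integrable M f \<and> log_integrable N g \<and> U (ae_eq M `` {f}) = ae_eq N `` {g})"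
proof (rule log_isometric_relation.intro, goal_cases)
  have image: "U ` L_log M = L_log N" and
    isometric: "\<And>F. F \<in> L_log M \<Longrightarrow> log_norm N (U F) = log_norm M F" and
    add: "\<And>F G. F \<in> L_log M \<Longrightarrow> G \<in> L_log M \<Longrightarrow> U (L0_add M F G) = L0_add N (U F) (U G)" and
    scale: "\<And>c F. F \<in> L_log M \<Longrightarrow> U (L0_scale M c F) = L0_scale N c (U F)"
    using U by (auto simp: L_log_isometry_def)
  have in_space: "ae_eq L `` {f} \<in> L_log L" "f \<in> borel_measurable L"
    if "log_integrable L f" for L :: "'c measure" and f :: "'c \<Rightarrow> 'k"
    using that log_integrable_iff_class by (auto simp: log_integrable_def)
  {
    case (5 f)
    then have "U (ae_eq M `` {f}) \<in> L_log N"
      using in_space image by blast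
    with 5 show ?case by (elim L_log_representative) auto
  next
    case (6 g)
    then have "ae_eq N `` {g} \<in> U ` L_log M"
      unfolding image by (rule in_space)
    then obtain F where "F \<in> L_log M" "U F = ae_eq N `` {g}" by auto
    with 6 show ?case by (elim L_log_representative) auto
  next
    case (7 f g f' g')
    then show ?case
      by (auto simp: in_space log_integrable_add L0_add_class[symmetric] add)
  next
    case (8 f g c)
    then show ?case
      by (auto simp: in_space log_integrable_scale finite L0_scale_class[symmetric] scale)
  next
    case (9 f g)
    then have "log_norm N (ae_eq N `` {g}) = log_norm M (ae_eq M `` {f})"
      using isometric[OF in_space(1), of f] by simp
    with 9 show ?case by (simp add: log_norm_class in_space(2) log_int_def)
  next
    case (10 f g f' g')
    then have "ae_eq M `` {f} = ae_eq M `` {f'}" "ae_eq N `` {g} = ae_eq N `` {g'}"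
      by (intro class_eqI; simp add: in_space(2))+
    then show ?case using 10 by (auto intro: log_integrable_cong_AE)
  }
qed (use finite in auto)

text \<open>Closure under almost everywhere equality and uniqueness of partners make the image of a
  class under the relation exactly one class, so taking images is the induced map.\<close>

lemma (in log_isometric_relation) image_class:
  assumes "W f g"
  shows "{g'. \<exists>f'\<in>ae_eq M `` {f}. W f' g'} = ae_eq N `` {g}"
proof -
  have "(\<exists>f'\<in>ae_eq M `` {f}. W f' g') \<longleftrightarrow> g' \<in> ae_eq N `` {g}" for g'
  proof
    assume "\<exists>f'\<in>ae_eq M `` {f}. W f' g'"
    then obtain f' where f': "W f' g'" "AE x in M. f x = f' x" by (auto simp: ae_eq_def)
    have "AE x in M. f' x = f x" using f'(2) by eventually_elim simp
    then have "W f g'"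
      using f'(1) meas_left[OF assms] meas_right[OF f'(1)] by (intro AE_closed[OF f'(1)]) auto
    then have "AE y in N. g y = g' y" by (rule unique_right[OF assms])
    then show "g' \<in> ae_eq N `` {g}"
      using meas_right[OF assms] meas_right[OF f'(1)] by (simp add: ae_eq_def)
  next
    assume "g' \<in> ae_eq N `` {g}"
    then have "W f g'"
      using meas_left[OF assms] by (intro AE_closed[OF assms]) (auto simp: ae_eq_def)
    then show "\<exists>f'\<in>ae_eq M `` {f}. W f' g'"
      using meas_left[OF assms] by (auto simp: ae_eq_def)
  qed
  then show ?thesis by blast
qed

lemma (in log_isometric_relation) isometry_of_relation:
  "L_log_isometry M N (\<lambda>F. {g. \<exists>f\<in>F. W f g})" (is "L_log_isometry M N ?U")
proof -
  have U_class: "?U (ae_eq M `` {f}) = ae_eq N `` {g}" if "W f g" for f g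
    by (rule image_class[OF that])
  have rep: "\<exists>f g. W f g \<and> F = ae_eq M `` {f}" if "F \<in> L_log M" for F
    using that left_total by (metis L_log_representative)
  have rep': "\<exists>f g. W f g \<and> G = ae_eq N `` {g}" if "G \<in> L_log N" for G :: "('b \<Rightarrow> 'k) set"
    using that right_total by (metis L_log_representative)
  show ?thesis
    unfolding L_log_isometry_def
  proof (intro conjI ballI allI)
    show "?U ` L_log M = L_log N"
    proof
      show "?U ` L_log M \<subseteq> L_log N"
      proof
        fix G :: "('b \<Rightarrow> 'k) set" assume "G \<in> ?U ` L_log M"
        then obtain f g where W: "W f g" and "G = ?U (ae_eq M `` {f})" using rep by blast
        then show "G \<in> L_log N"
          using U_class[OF W] integrable_right[OF W] log_integrable_iff_class[OF meas_right[OF W]] by simp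
      qed
      show "L_log N \<subseteq> ?U ` L_log M"
      proof
        fix G :: "('b \<Rightarrow> 'k) set" assume "G \<in> L_log N"
        then obtain f g where W: "W f g" and G: "G = ae_eq N `` {g}" using rep' by blast
        have "ae_eq M `` {f} \<in> L_log M"
          using integrable_left[OF W] log_integrable_iff_class[OF meas_left[OF W]] by simp
        with U_class[OF W] G show "G \<in> ?U ` L_log M" by blast
      qed
    qed
  next
    fix F G :: "('a \<Rightarrow> 'k) set" assume "F \<in> L_log M" "G \<in> L_log M"
    then obtain f g f' g' where W: "W f g" "W f' g'" and F: "F = ae_eq M `` {f}" and G: "G = ae_eq M `` {f'}"
      using rep by metis
    note m = meas_left[OF W(1)] meas_left[OF W(2)] meas_right[OF W(1)] meas_right[OF W(2)]
    show "?U (L0_add M F G) = L0_add N (?U F) (?U G)"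
      unfolding F G L0_add_class[OF m(1,2)] U_class[OF W(1)] U_class[OF W(2)] U_class[OF add[OF W]]
      by (rule L0_add_class[OF m(3,4), symmetric])
  next
    fix c and F :: "('a \<Rightarrow> 'k) set" assume "F \<in> L_log M"
    then obtain f g where W: "W f g" and F: "F = ae_eq M `` {f}" using rep by metis
    show "?U (L0_scale M c F) = L0_scale N c (?U F)"
      unfolding F L0_scale_class[OF meas_left[OF W]] U_class[OF W] U_class[OF scale[OF W]]
      by (rule L0_scale_class[OF meas_right[OF W], symmetric])
  next
    fix F :: "('a \<Rightarrow> 'k) set" assume "F \<in> L_log M"
    then obtain f g where W: "W f g" and F: "F = ae_eq M `` {f}" using rep by metis
    show "log_norm N (?U F) = log_norm M F"
      unfolding F U_class[OF W] log_norm_class[OF meas_left[OF W]] log_norm_class[OF meas_right[OF W]]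
      using isometric[OF W] by (simp add: log_int_def)
  qed
qed

lemma nabla_representative:
  assumes "e \<in> nabla M"
  obtains A where "A \<in> sets M" "e = set_eq M `` {A}"
  using assms unfolding nabla_def by (rule quotientE)

lemma set_class_in_nabla: "A \<in> sets M \<Longrightarrow> set_eq M `` {A} \<in> nabla M"
  unfolding nabla_def by (rule quotientI)

lemma measure_algebra_relation_of_iso:
  assumes finite: "finite_measure M" "finite_measure N"
    and iso: "measure_preserving_boolean_iso M N \<phi>"
  shows "measure_algebra_relation M N
    (\<lambda>A B. A \<in> sets M \<and> B \<in> sets N \<and> \<phi> (set_eq M `` {A}) = set_eq N `` {B})"
proof (rule measure_algebra_relation.intro, goal_cases)
  have image: "\<phi> ` nabla M = nabla N" and
    inf: "\<And>d e. d \<in> nabla M \<Longrightarrow> e \<in> nabla M \<Longrightarrow> \<phi> (nabla_inf M d e) = nabla_inf N (\<phi> d) (\<phi> e)" and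
    compl: "\<And>e. e \<in> nabla M \<Longrightarrow> \<phi> (nabla_compl M e) = nabla_compl N (\<phi> e)" and
    measure: "\<And>e. e \<in> nabla M \<Longrightarrow> nabla_measure N (\<phi> e) = nabla_measure M e"
    using iso by (auto simp: measure_preserving_boolean_iso_def boolean_iso_def bij_betw_def)
  {
    case (5 A)
    then have "\<phi> (set_eq M `` {A}) \<in> nabla N"
      using image set_class_in_nabla by blast
    with 5 show ?case by (elim nabla_representative) auto
  next
    case (6 B)
    then have "set_eq N `` {B} \<in> \<phi> ` nabla M"
      unfolding image by (rule set_class_in_nabla)
    then obtain e where "e \<in> nabla M" "\<phi> e = set_eq N `` {B}" by auto
    with 6 show ?case by (elim nabla_representative) auto
  next
    case (7 A B A' B')
    then show ?case
      by (auto simp: nabla_inf_class[symmetric] inf set_class_in_nabla)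
  next
    case (8 A B)
    then show ?case
      by (auto simp: nabla_compl_class[symmetric] compl set_class_in_nabla)
  next
    case (9 A B)
    then show ?case
      using measure[OF set_class_in_nabla, of A] by (auto simp: nabla_measure_class)
  next
    case (10 A B A' B')
    then have "set_eq M `` {A} = set_eq M `` {A'}" "set_eq N `` {B} = set_eq N `` {B'}"
      by (intro set_class_eqI; simp)+
    then show ?case using 10 by simp
  }
qed (use finite in auto)

lemma (in measure_algebra_relation) image_class:
  assumes "P A B"
  shows "{B'. \<exists>A'\<in>set_eq M `` {A}. P A' B'} = set_eq N `` {B}"
proof -
  note A = sets_left[OF assms] and B = sets_right[OF assms]
  have "(\<exists>A'\<in>set_eq M `` {A}. P A' B') \<longleftrightarrow> B' \<in> set_eq N `` {B}" for B'
  proof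
    assume "\<exists>A'\<in>set_eq M `` {A}. P A' B'"
    then obtain A' where A': "P A' B'" "A' \<in> set_eq M `` {A}" by blast
    have "AE x in M. x \<in> A' \<longleftrightarrow> x \<in> A"
      using in_set_class(2)[OF A A'(2)] by eventually_elim simp
    then have "P A B'"
      using A sets_right[OF A'(1)] by (intro AE_closed[OF A'(1)]) auto
    then have "AE y in N. y \<in> B \<longleftrightarrow> y \<in> B'" by (rule unique_right[OF assms])
    then show "B' \<in> set_eq N `` {B}"
      using B sets_right[OF A'(1)] by (simp add: set_eq_iff_AE)
  next
    assume "B' \<in> set_eq N `` {B}"
    then have "P A B'"
      using A B by (intro AE_closed[OF assms]) (auto dest: in_set_class)
    then show "\<exists>A'\<in>set_eq M `` {A}. P A' B'"
      using self_in_set_class[OF A] by blast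
  qed
  then show ?thesis by blast
qed

lemma (in measure_algebra_relation) iso_of_relation:
  "measure_preserving_boolean_iso M N (\<lambda>e. {B. \<exists>A\<in>e. P A B})" (is "measure_preserving_boolean_iso M N ?phi")
proof -
  have phi_class: "?phi (set_eq M `` {A}) = set_eq N `` {B}" if "P A B" for A B
    by (rule image_class[OF that])
  have rep: "\<exists>A B. P A B \<and> e = set_eq M `` {A}" if "e \<in> nabla M" for e
    using that left_total by (metis nabla_representative)
  have rep': "\<exists>A B. P A B \<and> e = set_eq N `` {B}" if "e \<in> nabla N" for e
    using that right_total by (metis nabla_representative)
  have inj: "inj_on ?phi (nabla M)"
  proof (rule inj_onI)
    fix d e assume de: "d \<in> nabla M" "e \<in> nabla M" "?phi d = ?phi e"
    then obtain A B A' B' where P: "P A B" "P A' B'" and d: "d = set_eq M `` {A}" and e: "e = set_eq M `` {A'}"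
      using rep by metis
    have "set_eq N `` {B} = set_eq N `` {B'}"
      using de(3) unfolding d e phi_class[OF P(1)] phi_class[OF P(2)] .
    then have "B' \<in> set_eq N `` {B}"
      using self_in_set_class[OF sets_right[OF P(2)]] by simp
    then have "P A B'"
      using in_set_class[OF sets_right[OF P(1)]] sets_left[OF P(1)] by (intro AE_closed[OF P(1)]) auto
    then have "AE x in M. x \<in> A \<longleftrightarrow> x \<in> A'"
      using P(2) by (rule unique_left)
    then show "d = e"
      unfolding d e using P by (intro set_class_eqI) (auto dest: sets_left)
  qed
  have image: "?phi ` nabla M = nabla N"
  proof
    show "?phi ` nabla M \<subseteq> nabla N"
    proof
      fix e assume "e \<in> ?phi ` nabla M"
      then obtain A B where P: "P A B" and e: "e = ?phi (set_eq M `` {A})" using rep by blast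
      show "e \<in> nabla N"
        unfolding e phi_class[OF P] by (rule set_class_in_nabla[OF sets_right[OF P]])
    qed
    show "nabla N \<subseteq> ?phi ` nabla M"
    proof
      fix e assume "e \<in> nabla N"
      then obtain A B where P: "P A B" and e: "e = set_eq N `` {B}" using rep' by blast
      have "e = ?phi (set_eq M `` {A})" unfolding e phi_class[OF P] ..
      then show "e \<in> ?phi ` nabla M" using set_class_in_nabla[OF sets_left[OF P]] by blast
    qed
  qed
  show ?thesis
    unfolding measure_preserving_boolean_iso_def boolean_iso_def bij_betw_def
  proof (intro conjI ballI inj image)
    fix d e assume "d \<in> nabla M" "e \<in> nabla M"
    then obtain A B A' B' where P: "P A B" "P A' B'" and d: "d = set_eq M `` {A}" and e: "e = set_eq M `` {A'}"
      using rep by metis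
    note s = sets_left[OF P(1)] sets_left[OF P(2)] sets_right[OF P(1)] sets_right[OF P(2)]
    show "?phi (nabla_sup M d e) = nabla_sup N (?phi d) (?phi e)"
      unfolding d e nabla_sup_class[OF s(1,2)] phi_class[OF P(1)] phi_class[OF P(2)] phi_class[OF Un[OF P]]
      by (rule nabla_sup_class[OF s(3,4), symmetric])
    show "?phi (nabla_inf M d e) = nabla_inf N (?phi d) (?phi e)"
      unfolding d e nabla_inf_class[OF s(1,2)] phi_class[OF P(1)] phi_class[OF P(2)] phi_class[OF Int[OF P]]
      by (rule nabla_inf_class[OF s(3,4), symmetric])
  next
    fix e assume "e \<in> nabla M"
    then obtain A B where P: "P A B" and e: "e = set_eq M `` {A}" using rep by metis
    show "?phi (nabla_compl M e) = nabla_compl N (?phi e)"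
      unfolding e nabla_compl_class[OF sets_left[OF P]] phi_class[OF P] phi_class[OF Compl[OF P]]
      by (rule nabla_compl_class[OF sets_right[OF P], symmetric])
    show "nabla_measure N (?phi e) = nabla_measure M e"
      unfolding e phi_class[OF P] nabla_measure_class[OF sets_left[OF P]] nabla_measure_class[OF sets_right[OF P]]
      by (rule measure_preserving[OF P])
  qed
qed

section \<open>Isometric spaces have isomorphic measure algebras\<close>

text \<open>Euclidean values are what allows a set relation to be lifted to functions coordinatewise; the
  instances are the real and the complex numbers.\<close>

theorem isometric_iff_measure_algebras_isomorphic:
  assumes "finite_measure M" "finite_measure N"
  shows "(\<exists>U :: ('a \<Rightarrow> 'k::{real_normed_field, euclidean_space}) set \<Rightarrow> ('b \<Rightarrow> 'k) set. L_log_isometry M N U) \<longleftrightarrow>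
    (\<exists>\<phi>. measure_preserving_boolean_iso M N \<phi>)"
proof
  assume "\<exists>U :: ('a \<Rightarrow> 'k) set \<Rightarrow> ('b \<Rightarrow> 'k) set. L_log_isometry M N U"
  then obtain U :: "('a \<Rightarrow> 'k) set \<Rightarrow> ('b \<Rightarrow> 'k) set" where "L_log_isometry M N U" ..
  note relation = log_isometric_relation_of_isometry[OF assms this]
  note measure_algebra_relation.iso_of_relation[OF log_isometric_relation.supp_relation[OF relation]]
  then show "\<exists>\<phi>. measure_preserving_boolean_iso M N \<phi>" by (intro exI)
next
  assume "\<exists>\<phi>. measure_preserving_boolean_iso M N \<phi>"
  then obtain \<phi> where "measure_preserving_boolean_iso M N \<phi>" ..
  note relation = measure_algebra_relation_of_iso[OF assms this]
  note log_isometric_relation.isometry_of_relation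
    [OF measure_algebra_relation.log_isometric_preimages_related[OF relation, where 'k = 'k]]
  then show "\<exists>U :: ('a \<Rightarrow> 'k) set \<Rightarrow> ('b \<Rightarrow> 'k) set. L_log_isometry M N U" by (intro exI)
qed

theorem theorem1p2:
  fixes M1 :: "'a measure" and M2 :: "'b measure"
  assumes "finite_measure M1" and "finite_measure M2"
  shows "((\<exists>U :: ('a \<Rightarrow> real) set \<Rightarrow> ('b \<Rightarrow> real) set. L_log_isometry M1 M2 U) \<longleftrightarrow>
            (\<exists>\<phi>. measure_preserving_boolean_iso M1 M2 \<phi>)) \<and>
         ((\<exists>U :: ('a \<Rightarrow> complex) set \<Rightarrow> ('b \<Rightarrow> complex) set. L_log_isometry M1 M2 U) \<longleftrightarrow>
            (\<exists>\<phi>. measure_preserving_boolean_iso M1 M2 \<phi>))"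
  using isometric_iff_measure_algebras_isomorphic[OF assms, where 'k = real]
    isometric_iff_measure_algebras_isomorphic[OF assms, where 'k = complex] by blast

end
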